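(* Let $f$ be an orientation-preserving harmonic mapping in $\mathbb D$ with $\|\omega_f\|_\infty<1$, and let $F=\mathscr B[f]=H+\overline G$ ($H,G$ analytic) be its canonical balanced representative. Put $k=\|G'/H'\|_\infty=k_{\mathrm{aff}}(f)<1$. Then $$\|P_H-P_f\|=\|P_H-P_F\|\le\mathcal C(k),$$ where, for $0<k<1$, $$\mathcal C(k)=\frac{\sqrt{x_k}\,(k^2-x_k)}{k(1-x_k)}=\frac{2x_k^{3/2}}{k(1+x_k)},$$ in which $x_k\in(0,1)$ is the unique solution $x\in(0,1)$ of $$\frac{\sqrt{x}\,(k^2-x)}{k(1-x)}=\frac{2x^{3/2}}{k(1+x)},$$ given by $$x_k=\frac{3-k^2-\sqrt{(1-k^2)(9-k^2)}}{2},$$ and $\mathcal C(0)=0$. The estimate is sharp for every $0<k<1$ (equality is attained by some such $f$ with $k_{\mathrm{aff}}(f)=k$). Moreover, $$\mathcal C(k)=\frac{2}{3\sqrt3}k^2+O(k^4)\qquad(k\to0).$$ For any orientation-preserving real-affine mapping $A$, the same estimate holds with the parameter $\|\omega_{A\circ f}\|_\infty$ in place of $k$, that is, $\|P_{H_A}-P_f\|\le\mathcal C(\|\omega_{A\circ f}\|_\infty)$, where $H_A$ is the analytic part of $A\circ f$; and balancing mappings $A$ minimize the parameter $\|\omega_{A\circ f}\|_\infty$ over all orientation-preserving real-affine $A$.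
   Context: $\mathbb D$ is the open unit disk in $\mathbb C$. An orientation-preserving harmonic mapping in $\mathbb D$ is a complex-valued harmonic function $f=h+\overline g$, with $h,g$ analytic in $\mathbb D$ ($h$ is the analytic part, $h'$ is independent of choices), whose Jacobian $J_f=|h'|^2-|g'|^2$ is positive everywhere; its complex dilatation $\omega_f=g'/h'$ is an analytic map $\mathbb D\to\mathbb D$. $\|\omega\|_\infty$ is the supremum norm on $\mathbb D$. Pre-Schwarzian: $P_f=(\log J_f)_z=\frac{h''}{h'}-\frac{\overline{\omega_f}\,\omega_f'}{1-|\omega_f|^2}$; for a locally univalent analytic $H$, $P_H=H''/H'$. For such functions $\|P\|=\sup_{z\in\mathbb D}(1-|z|^2)|P(z)|$. Orientation-preserving real-affine mappings: $A(w)=aw+b\overline w+c$, $|a|>|b|$. Hyperbolic distance: $d_{\mathbb D}(z_1,z_2)=2\operatorname{arctanh}\left|\frac{z_1-z_2}{1-\overline{z_2}z_1}\right|$. For a nonempty hyperbolically bounded $E\subset\mathbb D$, $\operatorname{rad}_{\mathbb D}(E)=\inf_{c\in\mathbb D}\sup_{\zeta\in E}d_{\mathbb D}(c,\zeta)$, attained at a unique point, the circumcenter of $E$. $r_{\mathrm{aff}}(f)$ and $c_{\mathrm{aff}}(f)$ are the circumradius and circumcenter of $\overline{\omega_f(\mathbb D)}$, and $k_{\mathrm{aff}}(f)=\tanh(r_{\mathrm{aff}}(f)/2)$. $A$ is a balancing mapping for $f$ if $c_{\mathrm{aff}}(A\circ f)=0$; such $A$ exist. The canonical balanced representative is $\mathscr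 B[f](z)=\frac{A(f(z))-A(f(0))}{(A\circ f)_z(0)}$ for any balancing $A$; it does not depend on the choice of $A$. *)

theory Defs
  imports "HOL-Complex_Analysis.Complex_Analysis" "HOL-Library.Landau_Symbols"
begin

abbreviation unit_disk :: "complex set" where
  "unit_disk \<equiv> ball 0 1"

section \<open>Harmonic mappings of the unit disk\<close>

text \<open>Only the values of functions on the disk matter; the disk is simply connected, so the
  complex-valued harmonic functions on it are the functions admitting the following decomposition.\<close>

definition harmonic_decomp ::
    "(complex \<Rightarrow> complex) \<Rightarrow> (complex \<Rightarrow> complex) \<Rightarrow> (complex \<Rightarrow> complex) \<Rightarrow> bool" where
  "harmonic_decomp f h g \<longleftrightarrow>
     h holomorphic_on unit_disk \<and> g holomorphic_on unit_disk \<and>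
     (\<forall>z\<in>unit_disk. f z = h z + cnj (g z))"

text \<open>The pair \<open>(h, g)\<close> is determined up to additive constants, so \<open>h'\<close> and \<open>g'\<close>
  do not depend on the choice made here.\<close>

definition harmonic_parts :: "(complex \<Rightarrow> complex) \<Rightarrow> (complex \<Rightarrow> complex) \<times> (complex \<Rightarrow> complex)" where
  "harmonic_parts f = (SOME (h, g). harmonic_decomp f h g)"

definition analytic_part :: "(complex \<Rightarrow> complex) \<Rightarrow> complex \<Rightarrow> complex" where
  "analytic_part f = fst (harmonic_parts f)"

definition coanalytic_part :: "(complex \<Rightarrow> complex) \<Rightarrow> complex \<Rightarrow> complex" where
  "coanalytic_part f = snd (harmonic_parts f)"

definition jacobian :: "(complex \<Rightarrow> complex) \<Rightarrow> complex \<Rightarrow> real" where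
  "jacobian f z =
     (cmod (deriv (analytic_part f) z))\<^sup>2 - (cmod (deriv (coanalytic_part f) z))\<^sup>2"

definition op_harmonic :: "(complex \<Rightarrow> complex) \<Rightarrow> bool" where
  "op_harmonic f \<longleftrightarrow>
     (\<exists>h g. harmonic_decomp f h g) \<and> (\<forall>z\<in>unit_disk. jacobian f z > 0)"

definition dilatation :: "(complex \<Rightarrow> complex) \<Rightarrow> complex \<Rightarrow> complex" where
  "dilatation f z = deriv (coanalytic_part f) z / deriv (analytic_part f) z"

text \<open>The real supremum is meaningful because it is applied only to dilatations of
  orientation-preserving harmonic mappings, which are bounded by 1 on the disk.\<close>

definition sup_norm :: "(complex \<Rightarrow> complex) \<Rightarrow> real" where
  "sup_norm \<phi> = (SUP z\<in>unit_disk. cmod (\<phi> z))"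

section \<open>Pre-Schwarzian derivatives\<close>

text \<open>The Wirtinger derivative \<open>\<partial>f/\<partial>z = (\<partial>f/\<partial>x - \<i> \<partial>f/\<partial>y) / 2\<close>.\<close>

definition wirtinger_z :: "(complex \<Rightarrow> complex) \<Rightarrow> complex \<Rightarrow> complex" where
  "wirtinger_z f z =
     (frechet_derivative f (at z) 1 - \<i> * frechet_derivative f (at z) \<i>) / 2"

definition pre_schwarzian :: "(complex \<Rightarrow> complex) \<Rightarrow> complex \<Rightarrow> complex" where
  "pre_schwarzian f = wirtinger_z (\<lambda>z. complex_of_real (ln (jacobian f z)))"

definition analytic_pre_schwarzian :: "(complex \<Rightarrow> complex) \<Rightarrow> complex \<Rightarrow> complex" where
  "analytic_pre_schwarzian H z = deriv (deriv H) z / deriv H z"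

text \<open>Extended-real valued, so that an inequality with a finite bound includes boundedness.\<close>

definition ps_norm :: "(complex \<Rightarrow> complex) \<Rightarrow> ereal" where
  "ps_norm P = (SUP z\<in>unit_disk. ereal ((1 - (cmod z)\<^sup>2) * cmod (P z)))"

section \<open>Hyperbolic circumradius and circumcenter\<close>

definition hyp_dist :: "complex \<Rightarrow> complex \<Rightarrow> real" where
  "hyp_dist z w = 2 * artanh (cmod ((z - w) / (1 - cnj w * z)))"

definition hyp_rad :: "complex set \<Rightarrow> real" where
  "hyp_rad E = (INF c\<in>unit_disk. SUP \<zeta>\<in>E. hyp_dist c \<zeta>)"

definition hyp_center :: "complex set \<Rightarrow> complex" where
  "hyp_center E = (THE c. c \<in> unit_disk \<and> (SUP \<zeta>\<in>E. hyp_dist c \<zeta>) = hyp_rad E)"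

definition r_aff :: "(complex \<Rightarrow> complex) \<Rightarrow> real" where
  "r_aff f = hyp_rad (closure (dilatation f ` unit_disk))"

definition c_aff :: "(complex \<Rightarrow> complex) \<Rightarrow> complex" where
  "c_aff f = hyp_center (closure (dilatation f ` unit_disk))"

definition k_aff :: "(complex \<Rightarrow> complex) \<Rightarrow> real" where
  "k_aff f = tanh (r_aff f / 2)"

section \<open>Balancing by real-affine mappings\<close>

definition op_affine :: "(complex \<Rightarrow> complex) \<Rightarrow> bool" where
  "op_affine A \<longleftrightarrow> (\<exists>a b c. cmod a > cmod b \<and> (\<forall>w. A w = a * w + b * cnj w + c))"

definition balancing :: "(complex \<Rightarrow> complex) \<Rightarrow> (complex \<Rightarrow> complex) \<Rightarrow> bool" where
  "balancing A f \<longleftrightarrow> op_affine A \<and> c_aff (A \<circ> f) = 0"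

text \<open>The result does not depend on which balancing mapping is chosen.\<close>

definition balanced_rep :: "(complex \<Rightarrow> complex) \<Rightarrow> complex \<Rightarrow> complex" where
  "balanced_rep f =
     (let A = (SOME A. balancing A f)
      in (\<lambda>z. (A (f z) - A (f 0)) / wirtinger_z (A \<circ> f) 0))"

section \<open>The extremal constant\<close>

definition extremal_eq :: "real \<Rightarrow> real \<Rightarrow> bool" where
  "extremal_eq k x \<longleftrightarrow>
     sqrt x * (k\<^sup>2 - x) / (k * (1 - x)) = 2 * x powr (3/2) / (k * (1 + x))"

definition x_sol :: "real \<Rightarrow> real" where
  "x_sol k = (THE x. 0 < x \<and> x < 1 \<and> extremal_eq k x)"

text \<open>Relevant only for \<open>0 \<le> k < 1\<close>.\<close>

definition C_bound :: "real \<Rightarrow> real" where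
  "C_bound k =
     (if k = 0 then 0
      else sqrt (x_sol k) * (k\<^sup>2 - x_sol k) / (k * (1 - x_sol k)))"

end

theory Submission
  imports Defs
begin

text \<open>If \<open>A \<circ> f = H + cnj G\<close> has dilatation \<open>\<omega>\<close>, then \<open>A \<circ> f\<close> and \<open>f\<close> have the same
  pre-Schwarzian derivative, because the Jacobian changes only by a constant factor, and the
  difference from that of \<open>H\<close> is \<open>cnj \<omega> \<omega>' / (1 - |\<omega>|\<^sup>2)\<close>. With \<open>k\<close> the supremum norm of \<open>\<omega>\<close> and
  \<open>t = |\<omega> z|\<close>, the Schwarz-Pick lemma applied to \<open>\<omega> / k\<close> bounds its weighted modulus by
  \<open>t (k\<^sup>2 - t\<^sup>2) / (k (1 - t\<^sup>2))\<close>, which is largest at \<open>t\<^sup>2 = x\<^sub>k\<close>.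
  Passing from \<open>f\<close> to \<open>A \<circ> f\<close> moves the dilatation by a disk automorphism, hence by a hyperbolic
  isometry, so choosing \<open>A\<close> amounts to choosing the point of the disk that is sent to the origin,
  and the smallest \<open>k\<close> results from the circumcenter of the range of the dilatation.\<close>

section \<open>Disk automorphisms and the pseudohyperbolic distance\<close>

text \<open>The circumcenter is a definite description, so existence and uniqueness of a minimizer
  precede any statement on balancing. Both are proved for the pseudohyperbolic distance, the
  hyperbolic tangent of half the hyperbolic one: its invariance is an algebraic identity, and the
  increasing function \<open>artanh\<close> carries minimizers back. The obstacles are that a
  minimizing sequence might escape to the unit circle and that two centers might tie.

  On the analytic side everything rests on the Hermitian form |p|^2 - |q|^2 at the pair (h', g'),
  which affine maps only rescale.

  The value x_k comes from calculus: differentiating t (k^2 - t^2) / (1 - t^2) and writing x = t^2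
  gives x^2 - (3 - k^2) x + k^2 = 0, which is also the condition for the two forms of the constant
  to agree.\<close>

definition pseudo_dist :: "complex \<Rightarrow> complex \<Rightarrow> real" where
  "pseudo_dist z w = cmod ((z - w) / (1 - cnj w * z))"

text \<open>The dilatation of \<open>a f + b cnj f + c\<close> is \<open>disk_aut a b\<close> applied to that of \<open>f\<close>.\<close>

definition disk_aut :: "complex \<Rightarrow> complex \<Rightarrow> complex \<Rightarrow> complex" where
  "disk_aut a b z = (cnj a * z + cnj b) / (a + b * z)"

lemma disk_aut_denom_nonzero:
  assumes "cmod b < cmod a" "cmod z \<le> 1"
  shows "a + b * z \<noteq> 0"
proof
  assume "a + b * z = 0"
  then have "cmod a = cmod b * cmod z"
    by (metis add_eq_0_iff norm_minus_cancel norm_mult)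
  also have "\<dots> \<le> cmod b" using assms(2) by (simp add: mult_left_le)
  finally show False using assms(1) by simp
qed

lemma one_minus_cnj_mult_nonzero:
  assumes "cmod w < 1" "cmod z \<le> 1"
  shows "1 - cnj w * z \<noteq> 0"
  using disk_aut_denom_nonzero[of "- cnj w" 1 z] assms by simp

lemma disk_aut_diff:
  assumes "cmod b < cmod a" "cmod z \<le> 1" "cmod w \<le> 1"
  shows "disk_aut a b z - disk_aut a b w
    = of_real ((cmod a)\<^sup>2 - (cmod b)\<^sup>2) * (z - w) / ((a + b * z) * (a + b * w))"
  using disk_aut_denom_nonzero[OF assms(1)] assms(2,3)
  by (simp add: disk_aut_def divide_simps complex_norm_square flip: of_real_power)
     (simp add: algebra_simps complex_norm_square)

lemma one_minus_cnj_disk_aut: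
  assumes "cmod b < cmod a" "cmod z \<le> 1" "cmod w \<le> 1"
  shows "1 - cnj (disk_aut a b w) * disk_aut a b z
    = of_real ((cmod a)\<^sup>2 - (cmod b)\<^sup>2) * (1 - cnj w * z) / ((a + b * z) * cnj (a + b * w))"
proof -
  have "a + b * z \<noteq> 0" "cnj (a + b * w) \<noteq> 0"
    using disk_aut_denom_nonzero[OF assms(1)] assms(2,3) by (auto simp del: complex_cnj_add)
  then show ?thesis
    by (simp add: disk_aut_def divide_simps complex_norm_square flip: of_real_power)
       (simp add: algebra_simps complex_norm_square)
qed

text \<open>Numerator and denominator acquire factors that differ only by conjugating a + b w, so
  the moduli cancel in the quotient.\<close>

lemma pseudo_dist_disk_aut:
  assumes "cmod b < cmod a" "cmod z \<le> 1" "cmod w \<le> 1"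
  shows "pseudo_dist (disk_aut a b z) (disk_aut a b w) = pseudo_dist z w"
proof -
  have "complex_of_real ((cmod a)\<^sup>2 - (cmod b)\<^sup>2) \<noteq> 0"
    using assms(1) by (simp add: power_strict_mono less_imp_neq[THEN not_sym] del: of_real_diff)
  moreover have "a + b * z \<noteq> 0" "a + b * w \<noteq> 0"
    using disk_aut_denom_nonzero[OF assms(1)] assms(2,3) by auto
  moreover have "cmod (cnj (a + b * w)) = cmod (a + b * w)" by (rule complex_mod_cnj)
  ultimately show ?thesis
    unfolding pseudo_dist_def disk_aut_diff[OF assms] one_minus_cnj_disk_aut[OF assms] norm_divide norm_mult
    by (simp del: complex_cnj_add complex_cnj_mult of_real_diff)
qed

lemma one_minus_norm_disk_aut:
  assumes "cmod b < cmod a" "cmod z \<le> 1"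
  shows "1 - (cmod (disk_aut a b z))\<^sup>2
    = ((cmod a)\<^sup>2 - (cmod b)\<^sup>2) * (1 - (cmod z)\<^sup>2) / (cmod (a + b * z))\<^sup>2"
proof -
  have "complex_of_real (1 - (cmod (disk_aut a b z))\<^sup>2)
      = 1 - cnj (disk_aut a b z) * disk_aut a b z"
    by (simp add: complex_norm_square mult.commute flip: of_real_power)
  also have "\<dots> = of_real ((cmod a)\<^sup>2 - (cmod b)\<^sup>2) * (1 - cnj z * z) / ((a + b * z) * cnj (a + b * z))"
    by (rule one_minus_cnj_disk_aut[OF assms assms(2)])
  also have "\<dots> = of_real (((cmod a)\<^sup>2 - (cmod b)\<^sup>2) * (1 - (cmod z)\<^sup>2) / (cmod (a + b * z))\<^sup>2)"
    by (simp add: complex_norm_square mult.commute del: complex_cnj_add complex_cnj_mult flip: of_real_power)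
  finally show ?thesis by (simp only: of_real_eq_iff)
qed

lemma norm_disk_aut_less_1:
  assumes "cmod b < cmod a" "cmod z < 1"
  shows "cmod (disk_aut a b z) < 1"
proof -
  have "(cmod b)\<^sup>2 < (cmod a)\<^sup>2" "(cmod z)\<^sup>2 < 1"
    using assms by (simp_all add: power_strict_mono abs_square_less_1)
  moreover have "a + b * z \<noteq> 0" using disk_aut_denom_nonzero assms by simp
  ultimately have "0 < 1 - (cmod (disk_aut a b z))\<^sup>2"
    using one_minus_norm_disk_aut[of b a z] assms by simp
  then show ?thesis using abs_square_less_1[of "cmod (disk_aut a b z)"] by simp
qed

text \<open>The matrix with rows (\<open>cnj a\<close>, \<open>cnj b\<close>) and (\<open>b\<close>,
  \<open>a\<close>) has an adjugate of the same kind, with \<open>cnj a\<close> and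
  \<open>- b\<close> in place of \<open>a\<close> and \<open>b\<close>. Repeating this passage
  restores \<open>a\<close> and \<open>b\<close>, so the second claim is an instance of the
  first.\<close>

lemma disk_aut_inverse:
  assumes "cmod b < cmod a" "cmod z < 1"
  shows "disk_aut (cnj a) (- b) (disk_aut a b z) = z"
    and "disk_aut a b (disk_aut (cnj a) (- b) z) = z"
proof -
  have *: "disk_aut (cnj a) (- b) (disk_aut a b z) = z" if "cmod b < cmod a" "cmod z < 1" for a b z
  proof -
    have d: "a + b * z \<noteq> 0" using disk_aut_denom_nonzero that by simp
    have "cmod (disk_aut a b z) \<le> 1" using norm_disk_aut_less_1[OF that] by simp
    then have "cnj a + (- b) * disk_aut a b z \<noteq> 0"
      using disk_aut_denom_nonzero[of "- b" "cnj a"] that by simp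
    then have "cnj a * (a + b * z) - b * (cnj a * z + cnj b) \<noteq> 0"
      using d by (simp add: disk_aut_def field_simps)
    then have "cnj a * a - b * cnj b \<noteq> 0" by (simp add: algebra_simps)
    moreover have "disk_aut (cnj a) (- b) (disk_aut a b z)
        = (a * (cnj a * z + cnj b) - cnj b * (a + b * z)) / (cnj a * (a + b * z) - b * (cnj a * z + cnj b))"
      using d by (simp add: disk_aut_def add_divide_distrib diff_divide_distrib flip: divide_divide_eq_right)
        (simp add: divide_simps)
    moreover have "a * (cnj a * z + cnj b) - cnj b * (a + b * z) = (cnj a * a - b * cnj b) * z"
      "cnj a * (a + b * z) - b * (cnj a * z + cnj b) = cnj a * a - b * cnj b"
      by (simp_all add: algebra_simps)
    ultimately show ?thesis by simp
  qed
  from *[OF assms] show "disk_aut (cnj a) (- b) (disk_aut a b z) = z" .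
  from *[of "- b" "cnj a" z] assms show "disk_aut a b (disk_aut (cnj a) (- b) z) = z" by simp
qed

lemma has_field_derivative_disk_aut:
  assumes "cmod b < cmod a" "cmod z \<le> 1"
  shows "(disk_aut a b has_field_derivative
    of_real ((cmod a)\<^sup>2 - (cmod b)\<^sup>2) / (a + b * z)\<^sup>2) (at z)"
proof -
  have d: "a + b * z \<noteq> 0" using disk_aut_denom_nonzero assms by simp
  have "((\<lambda>z. (cnj a * z + cnj b) / (a + b * z)) has_field_derivative
     (cnj a * (a + b * z) - (cnj a * z + cnj b) * b) / ((a + b * z) * (a + b * z))) (at z)"
    by (intro DERIV_divide d) (auto intro!: derivative_eq_intros)
  moreover have "cnj a * (a + b * z) - (cnj a * z + cnj b) * b = of_real ((cmod a)\<^sup>2 - (cmod b)\<^sup>2)"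
    by (simp add: algebra_simps complex_norm_square flip: of_real_power)
  ultimately have "((\<lambda>z. (cnj a * z + cnj b) / (a + b * z)) has_field_derivative
     of_real ((cmod a)\<^sup>2 - (cmod b)\<^sup>2) / (a + b * z)\<^sup>2) (at z)"
    by (simp only: power2_eq_square[of "a + b * z"])
  then show ?thesis by (simp add: disk_aut_def[abs_def])
qed

lemma pseudo_dist_conv_disk_aut: "pseudo_dist z w = cmod (disk_aut 1 (- cnj w) z)"
  by (simp add: pseudo_dist_def disk_aut_def)

lemma pseudo_dist_commute: "pseudo_dist z w = pseudo_dist w z"
proof -
  have "cmod (1 - cnj w * z) = cmod (1 - cnj z * w)"
    by (metis complex_cnj_cnj complex_cnj_diff complex_cnj_mult complex_cnj_one complex_mod_cnj mult.commute)
  then show ?thesis by (simp add: pseudo_dist_def norm_divide norm_minus_commute)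
qed

lemma pseudo_dist_nonneg: "0 \<le> pseudo_dist z w"
  by (simp add: pseudo_dist_def)

lemma pseudo_dist_0: "pseudo_dist 0 w = cmod w"
  by (simp add: pseudo_dist_def)

lemma pseudo_dist_less_1: "\<lbrakk>cmod z < 1; cmod w < 1\<rbrakk> \<Longrightarrow> pseudo_dist z w < 1"
  unfolding pseudo_dist_conv_disk_aut by (rule norm_disk_aut_less_1) auto

lemma one_minus_pseudo_dist:
  assumes "cmod w < 1" "cmod z \<le> 1"
  shows "1 - (pseudo_dist z w)\<^sup>2 = (1 - (cmod z)\<^sup>2) * (1 - (cmod w)\<^sup>2) / (cmod (1 - cnj w * z))\<^sup>2"
  using one_minus_norm_disk_aut[of "- cnj w" 1 z] assms by (simp add: pseudo_dist_conv_disk_aut)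

lemma hyp_dist_conv: "hyp_dist z w = 2 * artanh (pseudo_dist z w)"
  by (simp add: hyp_dist_def pseudo_dist_def)

text \<open>One of \<open>\<plusminus> n\<close> is at an angle of at least \<open>\<pi> / 2\<close> to \<open>z\<close>; if it is \<open>n\<close>, then \<open>|1 - cnj n * z| \<ge> 1\<close>.\<close>

lemma norm_bound_of_symmetric_pseudo_dist:
  assumes n: "cmod n < 1" and z: "cmod z < 1"
    and "pseudo_dist n z \<le> R" "pseudo_dist (- n) z \<le> R"
  shows "(cmod z)\<^sup>2 \<le> 1 - (1 - R\<^sup>2) / (1 - (cmod n)\<^sup>2)"
proof -
  have key: "(cmod z)\<^sup>2 \<le> 1 - (1 - R\<^sup>2) / (1 - (cmod n)\<^sup>2)"
    if n: "cmod n < 1" and R: "pseudo_dist n z \<le> R" and le: "Re (cnj n * z) \<le> 0" for n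
  proof -
    have "(1::real) \<le> Re (1 - cnj n * z)" using le by simp
    also have "\<dots> \<le> cmod (1 - cnj n * z)" by (rule complex_Re_le_cmod)
    finally have 1: "1 \<le> (cmod (1 - cnj n * z))\<^sup>2" by simp
    have pos: "0 < 1 - (cmod n)\<^sup>2" "0 < 1 - (cmod z)\<^sup>2"
      using n z by (simp_all add: abs_square_less_1)
    have "(pseudo_dist n z)\<^sup>2 \<le> R\<^sup>2" using R by (simp add: power_mono pseudo_dist_nonneg)
    then have "1 - R\<^sup>2 \<le> 1 - (pseudo_dist z n)\<^sup>2" by (simp add: pseudo_dist_commute[of z n])
    also have "\<dots> = (1 - (cmod z)\<^sup>2) * (1 - (cmod n)\<^sup>2) / (cmod (1 - cnj n * z))\<^sup>2"
      using one_minus_pseudo_dist[of n z] n z by simp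
    also have "\<dots> \<le> (1 - (cmod z)\<^sup>2) * (1 - (cmod n)\<^sup>2) / 1"
      using pos 1 by (intro divide_left_mono) auto
    finally show ?thesis using pos by (simp add: field_simps)
  qed
  show ?thesis
  proof (cases "Re (cnj n * z) \<le> 0")
    case True
    then show ?thesis using key[of n] assms by simp
  next
    case False
    then show ?thesis using key[of "- n"] assms by simp
  qed
qed

text \<open>A disk automorphism taking the hyperbolic midpoint \<open>m\<close> of \<open>c\<close> and \<open>d\<close> to the origin sends
  \<open>c\<close> and \<open>d\<close> to opposite points \<open>\<plusminus> n\<close>.\<close>

lemma pseudo_dist_midpoint:
  assumes "cmod c < 1" "cmod d < 1" "c \<noteq> d" "0 \<le> R" "R < 1"
  obtains m R' where "cmod m < 1" "R' < R"
    "\<And>z. \<lbrakk>cmod z < 1; pseudo_dist c z \<le> R; pseudo_dist d z \<le> R\<rbrakk> \<Longrightarrow> pseudo_dist m z \<le> R'"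
proof -
  define w where "w = disk_aut 1 (- cnj c) d"
  have cc: "disk_aut 1 (- cnj c) c = 0" by (simp add: disk_aut_def)
  have w1: "cmod w < 1" using norm_disk_aut_less_1[of "- cnj c" 1 d] assms by (simp add: w_def)
  have w0: "w \<noteq> 0"
    using one_minus_cnj_mult_nonzero[of c d] assms by (simp add: w_def disk_aut_def)
  \<comment> \<open>The hyperbolic midpoint \<open>n\<close> of 0 and \<open>w\<close> satisfies 2 n
    / (1 + |n|^2) = w; the solution in the disk is n = w / (1 + q) with q = sqrt (1 -
    |w|^2).\<close>
  define q where "q = sqrt (1 - (cmod w)\<^sup>2)"
  have q: "q\<^sup>2 = 1 - (cmod w)\<^sup>2" "0 < q" "q < 1"
    using w1 w0 by (auto simp: q_def abs_square_less_1 abs_square_le_1)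
  define n where "n = w / of_real (1 + q)"
  have nw: "w = of_real (1 + q) * n" using q by (simp add: n_def del: of_real_add)
  have qn: "(1 + q) * (cmod n)\<^sup>2 = 1 - q"
  proof -
    have "(1 + q) * ((1 + q) * (cmod n)\<^sup>2) = (cmod w)\<^sup>2"
      using q by (subst nw) (simp add: norm_mult power2_eq_square del: of_real_add)
    also have "\<dots> = (1 + q) * (1 - q)" using q by (simp add: algebra_simps power2_eq_square)
    finally show ?thesis using q by (subst (asm) mult_left_cancel) auto
  qed
  have n1: "cmod n < 1"
  proof -
    have "(1 + q) * (cmod n)\<^sup>2 < (1 + q) * 1" using qn q by simp
    then have "(cmod n)\<^sup>2 < 1" using q by (subst (asm) mult_less_cancel_left_pos) auto
    then show ?thesis by (simp add: abs_square_less_1)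
  qed
  have n0: "n \<noteq> 0" using w0 nw by auto
  have wn: "disk_aut 1 (- cnj n) w = n"
  proof -
    have "w - n = n * (1 - cnj n * w)"
    proof -
      have "n * (1 - cnj n * w) = n * (1 - of_real ((1 + q) * (cmod n)\<^sup>2))"
        by (subst nw) (simp add: complex_norm_square algebra_simps flip: of_real_power)
      also have "\<dots> = n * of_real q" unfolding qn by simp
      finally show ?thesis by (simp add: nw algebra_simps)
    qed
    then show ?thesis using one_minus_cnj_mult_nonzero[of n w] n1 w1
      by (simp add: disk_aut_def divide_simps)
  qed
  define T where "T z = disk_aut 1 (- cnj n) (disk_aut 1 (- cnj c) z)" for z
  have T1: "cmod (T z) < 1" if "cmod z < 1" for z
    using that assms n1 by (simp add: T_def norm_disk_aut_less_1)
  have Tpd: "pseudo_dist (T x) (T y) = pseudo_dist x y" if "cmod x < 1" "cmod y < 1" for x y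
    using that assms n1 norm_disk_aut_less_1[of "- cnj c" 1]
    by (simp add: T_def pseudo_dist_disk_aut less_imp_le)
  define m where "m = disk_aut 1 (cnj c) n"
  have m1: "cmod m < 1" using assms n1 by (simp add: m_def norm_disk_aut_less_1)
  have Tm: "T m = 0"
    using disk_aut_inverse(2)[of "- cnj c" 1 n] assms n1
    by (simp add: T_def m_def) (simp add: disk_aut_def)
  have Tc: "T c = - n" and Td: "T d = n"
    by (simp_all add: T_def cc wn flip: w_def) (simp add: disk_aut_def)
  \<comment> \<open>The bound of \<open>norm_bound_of_symmetric_pseudo_dist\<close>. It is strictly
    below R^2 because \<open>n\<close> is nonzero, as \<open>c\<close> and \<open>d\<close> differ,
    and because R < 1.\<close>
  define R2 where "R2 = 1 - (1 - R\<^sup>2) / (1 - (cmod n)\<^sup>2)"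
  have R2: "R2 < R\<^sup>2"
  proof -
    have "(cmod n)\<^sup>2 < 1" "0 < (cmod n)\<^sup>2" "R\<^sup>2 < 1" using n1 n0 assms by (simp_all add: abs_square_less_1)
    then have "(1 - R\<^sup>2) * (1 - (cmod n)\<^sup>2) < (1 - R\<^sup>2) * 1" by (intro mult_strict_left_mono) auto
    then have "1 - R\<^sup>2 < (1 - R\<^sup>2) / (1 - (cmod n)\<^sup>2)" using \<open>(cmod n)\<^sup>2 < 1\<close> by (simp add: field_simps)
    then show ?thesis by (simp add: R2_def)
  qed
  \<comment> \<open>If \<open>R2\<close> is negative, no point of the disk satisfies both bounds and
    any value below \<open>R\<close> serves, here \<open>R - 1\<close>.\<close>
  show ?thesis
  proof (rule that[of m "if R2 < 0 then R - 1 else sqrt R2"])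
    show "cmod m < 1" by (rule m1)
    show "(if R2 < 0 then R - 1 else sqrt R2) < R"
      using R2 assms(4) by (auto intro: real_less_lsqrt)
    fix z assume z: "cmod z < 1" "pseudo_dist c z \<le> R" "pseudo_dist d z \<le> R"
    have "(cmod (T z))\<^sup>2 \<le> R2"
      unfolding R2_def
      by (rule norm_bound_of_symmetric_pseudo_dist)
         (use z n1 T1 Tpd[of c z] Tpd[of d z] assms in \<open>auto simp: Tc Td\<close>)
    moreover have "pseudo_dist m z = cmod (T z)"
      using Tpd[of m z] z m1 by (simp add: Tm pseudo_dist_0)
    moreover have "0 \<le> R2" using calculation(1) by (rule order_trans[rotated]) simp
    ultimately show "pseudo_dist m z \<le> (if R2 < 0 then R - 1 else sqrt R2)"
      by (auto intro: real_le_rsqrt)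
  qed
qed

section \<open>The hyperbolic circumcenter\<close>

lemma tanh_artanh_real:
  fixes x :: real
  assumes "\<bar>x\<bar> < 1"
  shows "tanh (artanh x) = x"
proof -
  have "exp (- 2 * artanh x) = (1 - x) / (1 + x)"
    using assms by (simp add: artanh_def exp_minus exp_ln)
  moreover have "1 - (1 - x) / (1 + x) = 2 * x / (1 + x)" "1 + (1 - x) / (1 + x) = 2 / (1 + x)"
    using assms by (simp_all add: field_simps)
  ultimately show ?thesis
    using assms unfolding tanh_real_altdef by simp
qed

lemma artanh_real_le_iff:
  fixes x y :: real
  assumes "\<bar>x\<bar> < 1" "\<bar>y\<bar> < 1"
  shows "artanh x \<le> artanh y \<longleftrightarrow> x \<le> y"
  using tanh_real_le_iff[of "artanh x" "artanh y"] assms by (simp add: tanh_artanh_real del: tanh_real_le_iff)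

text \<open>The supremum inside \<open>hyp_rad\<close>, measured pseudohyperbolically. For compact
  subsets of the disk the two differ by the increasing map 2 artanh, so they have the same
  minimizers.\<close>

definition pseudo_ecc :: "complex set \<Rightarrow> complex \<Rightarrow> real" where
  "pseudo_ecc E c = (SUP z\<in>E. pseudo_dist c z)"

context
  fixes E :: "complex set"
  assumes E: "compact E" "E \<noteq> {}" "E \<subseteq> ball 0 1"
begin

text \<open>A farthest point inside the open disk keeps the eccentricity below 1, in the domain of
  \<open>artanh\<close>, and lets \<open>artanh\<close> pass through the supremum.\<close>

lemma pseudo_ecc_attained:
  assumes "cmod c < 1"
  obtains z where "z \<in> E" "pseudo_ecc E c = pseudo_dist c z"
    "\<And>z'. z' \<in> E \<Longrightarrow> pseudo_dist c z' \<le> pseudo_ecc E c"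
proof -
  have "continuous_on E (\<lambda>z. pseudo_dist z c)"
    unfolding pseudo_dist_def using E(3) assms one_minus_cnj_mult_nonzero[of c]
    by (auto intro!: continuous_intros)
  then obtain z where z: "z \<in> E" "\<And>z'. z' \<in> E \<Longrightarrow> pseudo_dist z' c \<le> pseudo_dist z c"
    using continuous_attains_sup[OF E(1,2)] by blast
  then have "pseudo_ecc E c = pseudo_dist c z"
    unfolding pseudo_ecc_def by (intro cSup_eq_maximum) (auto simp: pseudo_dist_commute[of c])
  then show ?thesis using z by (intro that[of z]) (auto simp: pseudo_dist_commute[of c])
qed

lemma pseudo_ecc_le_iff:
  assumes "cmod c < 1"
  shows "pseudo_ecc E c \<le> r \<longleftrightarrow> (\<forall>z\<in>E. pseudo_dist c z \<le> r)"
  using pseudo_ecc_attained[OF assms] by (metis order_trans)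

lemma pseudo_ecc_bounds:
  assumes "cmod c < 1"
  shows "0 \<le> pseudo_ecc E c" "pseudo_ecc E c < 1"
proof -
  obtain z where z: "z \<in> E" "pseudo_ecc E c = pseudo_dist c z"
    using pseudo_ecc_attained[OF assms] by metis
  then show "0 \<le> pseudo_ecc E c" "pseudo_ecc E c < 1"
    using E(3) assms by (auto simp: pseudo_dist_nonneg intro!: pseudo_dist_less_1)
qed

lemma Sup_hyp_dist:
  assumes "cmod c < 1"
  shows "(SUP z\<in>E. hyp_dist c z) = 2 * artanh (pseudo_ecc E c)"
proof -
  obtain z where z: "z \<in> E" "pseudo_ecc E c = pseudo_dist c z"
    "\<And>z'. z' \<in> E \<Longrightarrow> pseudo_dist c z' \<le> pseudo_ecc E c"
    using pseudo_ecc_attained[OF assms] by metis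
  have "artanh (pseudo_dist c z') \<le> artanh (pseudo_dist c z)" if "z' \<in> E" for z'
    using z(3)[OF that] z(2) pseudo_ecc_bounds[OF assms] pseudo_dist_nonneg[of c z']
    by (simp add: artanh_real_le_iff)
  with z(1) show ?thesis
    unfolding z(2) by (intro cSup_eq_maximum) (auto simp: hyp_dist_conv)
qed

text \<open>A minimizing sequence subconverges in the closed disk by compactness; the work lies in
  excluding a limit on the unit circle.\<close>

lemma pseudo_ecc_minimum:
  obtains c where "cmod c < 1" "\<And>c'. cmod c' < 1 \<Longrightarrow> pseudo_ecc E c \<le> pseudo_ecc E c'"
proof -
  define R where "R = (INF c\<in>ball 0 1. pseudo_ecc E c)"
  have bdd: "bdd_below (pseudo_ecc E ` ball 0 1)"
    by (rule bdd_belowI[of _ 0]) (auto simp: pseudo_ecc_bounds)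
  have R_le: "R \<le> pseudo_ecc E c" if "cmod c < 1" for c
    unfolding R_def using that by (intro cINF_lower bdd) auto
  have R1: "R < 1" using R_le[of 0] pseudo_ecc_bounds[of 0] by simp
  have "\<exists>c. cmod c < 1 \<and> pseudo_ecc E c < R + 1 / real (Suc n)" for n
  proof -
    have "R < R + 1 / real (Suc n)" by simp
    then show ?thesis unfolding R_def by (subst (asm) cINF_less_iff) (use bdd in auto)
  qed
  then obtain c where c: "\<And>n. cmod (c n) < 1" "\<And>n. pseudo_ecc E (c n) < R + 1 / real (Suc n)"
    by metis
  have "\<forall>n. c n \<in> cball 0 1" using c(1) by (simp add: less_imp_le)
  then obtain l r where l: "l \<in> cball 0 1" and r: "strict_mono r" and lim: "(c \<circ> r) \<longlonglongrightarrow> l"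
    using compact_cball[of "0::complex" 1] unfolding compact_def by metis
  have "(\<lambda>n. R + 1 / real (Suc n)) \<longlonglongrightarrow> R + 0"
    by (intro tendsto_add tendsto_const LIMSEQ_Suc lim_1_over_n)
  from LIMSEQ_subseq_LIMSEQ[OF this r]
  have limR: "(\<lambda>n. R + 1 / real (Suc (r n))) \<longlonglongrightarrow> R" by (simp add: o_def)
  \<comment> \<open>With the denominator cleared, the inequality passes to the limit by continuity,
    also when \<open>l\<close> lies on the unit circle.\<close>
  have le: "cmod (l - z) \<le> R * cmod (1 - cnj z * l)" if z: "z \<in> E" for z
  proof (rule LIMSEQ_le)
    show "(\<lambda>n. cmod ((c \<circ> r) n - z)) \<longlonglongrightarrow> cmod (l - z)"
      by (intro tendsto_intros lim)
    show "(\<lambda>n. (R + 1 / real (Suc (r n))) * cmod (1 - cnj z * (c \<circ> r) n)) \<longlonglongrightarrow> R * cmod (1 - cnj z * l)"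
      by (intro tendsto_intros lim limR)
    have "cmod ((c \<circ> r) n - z) \<le> (R + 1 / real (Suc (r n))) * cmod (1 - cnj z * (c \<circ> r) n)" for n
    proof -
      have "1 - cnj z * c (r n) \<noteq> 0"
        using one_minus_cnj_mult_nonzero[of z "c (r n)"] z E(3) c(1)[of "r n"] by auto
      moreover have "pseudo_dist (c (r n)) z \<le> R + 1 / real (Suc (r n))"
        using pseudo_ecc_le_iff[OF c(1)] c(2)[of "r n"] z by (meson less_imp_le)
      ultimately show ?thesis by (simp add: pseudo_dist_def norm_divide field_simps)
    qed
    then show "\<exists>N. \<forall>n\<ge>N. cmod ((c \<circ> r) n - z)
        \<le> (R + 1 / real (Suc (r n))) * cmod (1 - cnj z * (c \<circ> r) n)"
      by blast
  qed
  obtain z0 where z0: "z0 \<in> E" using E(2) by blast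
  \<comment> \<open>On the unit circle 1 - cnj z0 l = cnj (l - z0) l, so the two moduli in the limit
    inequality coincide and are positive, contrary to R < 1.\<close>
  have l1: "cmod l < 1"
  proof (rule ccontr)
    assume "\<not> cmod l < 1"
    then have l_1: "cmod l = 1" using l by simp
    then have "cnj l * l = 1" by (metis complex_norm_square mult.commute of_real_1 power_one)
    then have "cmod (1 - cnj z0 * l) = cmod (cnj (l - z0) * l)" by (simp add: algebra_simps)
    also have "\<dots> = cmod (l - z0)"
      by (metis complex_mod_cnj l_1 mult.right_neutral norm_mult)
    finally have "cmod (l - z0) \<le> R * cmod (l - z0)" using le[OF z0] by simp
    moreover have "0 < cmod (l - z0)" using z0 E(3) l_1 by auto
    ultimately show False using R1 by simp
  qed
  have "pseudo_dist l z \<le> R" if z: "z \<in> E" for z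
  proof -
    have "1 - cnj z * l \<noteq> 0"
      using one_minus_cnj_mult_nonzero[of z l] z E(3) l1 by auto
    then show ?thesis using le[OF z] by (simp add: pseudo_dist_def norm_divide field_simps)
  qed
  then have "pseudo_ecc E l \<le> R" using pseudo_ecc_le_iff[OF l1] by blast
  then show ?thesis using R_le l1 by (intro that[of l]) (auto intro: order_trans)
qed

text \<open>The hyperbolic midpoint of two distinct minimizers would have a strictly smaller
  eccentricity.\<close>

lemma pseudo_ecc_minimum_unique:
  assumes "cmod c < 1" "\<And>c'. cmod c' < 1 \<Longrightarrow> pseudo_ecc E c \<le> pseudo_ecc E c'"
    and "cmod d < 1" "pseudo_ecc E d \<le> pseudo_ecc E c"
  shows "c = d"
proof (rule ccontr)
  assume "c \<noteq> d"
  then obtain m R' where m: "cmod m < 1" "R' < pseudo_ecc E c"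
    "\<And>z. \<lbrakk>cmod z < 1; pseudo_dist c z \<le> pseudo_ecc E c; pseudo_dist d z \<le> pseudo_ecc E c\<rbrakk>
       \<Longrightarrow> pseudo_dist m z \<le> R'"
    using pseudo_dist_midpoint[OF assms(1,3) _ pseudo_ecc_bounds[OF assms(1)]] by metis
  have "pseudo_dist m z \<le> R'" if "z \<in> E" for z
    using that E(3) assms(4) pseudo_ecc_le_iff[OF assms(1), of "pseudo_ecc E c"]
      pseudo_ecc_le_iff[OF assms(3), of "pseudo_ecc E c"]
    by (intro m(3)) auto
  then have "pseudo_ecc E m \<le> R'" using pseudo_ecc_le_iff[OF m(1)] by blast
  then show False using assms(2)[OF m(1)] m(2) by simp
qed

text \<open>Monotonicity of \<open>artanh\<close> transfers the minimum from
  \<open>pseudo_ecc\<close> to the hyperbolic supremum; uniqueness of the minimizer is what resolves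
  the definite description.\<close>

lemma hyp_center_rad_eqI:
  assumes "cmod c < 1" "\<And>c'. cmod c' < 1 \<Longrightarrow> pseudo_ecc E c \<le> pseudo_ecc E c'"
  shows "hyp_center E = c" and "hyp_rad E = 2 * artanh (pseudo_ecc E c)"
proof -
  have mono: "artanh (pseudo_ecc E x) \<le> artanh (pseudo_ecc E y)
      \<longleftrightarrow> pseudo_ecc E x \<le> pseudo_ecc E y" if "cmod x < 1" "cmod y < 1" for x y
    using that pseudo_ecc_bounds[of x] pseudo_ecc_bounds[of y] by (simp add: artanh_real_le_iff)
  show rad: "hyp_rad E = 2 * artanh (pseudo_ecc E c)"
    unfolding hyp_rad_def
  proof (rule cInf_eq_minimum)
    show "2 * artanh (pseudo_ecc E c) \<in> (\<lambda>c. SUP z\<in>E. hyp_dist c z) ` ball 0 1"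
      using assms(1) by (intro image_eqI[of _ _ c]) (auto simp: Sup_hyp_dist)
    show "2 * artanh (pseudo_ecc E c) \<le> x" if "x \<in> (\<lambda>c. SUP z\<in>E. hyp_dist c z) ` ball 0 1" for x
      using that assms by (auto simp: Sup_hyp_dist mono)
  qed
  show "hyp_center E = c"
    unfolding hyp_center_def rad
  proof (rule the_equality)
    show "c \<in> ball 0 1 \<and> (SUP z\<in>E. hyp_dist c z) = 2 * artanh (pseudo_ecc E c)"
      using assms(1) by (simp add: Sup_hyp_dist)
    fix d assume d: "d \<in> ball 0 1 \<and> (SUP z\<in>E. hyp_dist d z) = 2 * artanh (pseudo_ecc E c)"
    then have "artanh (pseudo_ecc E d) \<le> artanh (pseudo_ecc E c)" using Sup_hyp_dist[of d] by simp
    then have "pseudo_ecc E d \<le> pseudo_ecc E c" using d assms(1) by (simp add: mono)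
    then show "d = c" using pseudo_ecc_minimum_unique[OF assms, of d] d by auto
  qed
qed

lemma hyp_center_in_disk: "cmod (hyp_center E) < 1"
  and pseudo_ecc_hyp_center_le: "cmod c < 1 \<Longrightarrow> pseudo_ecc E (hyp_center E) \<le> pseudo_ecc E c"
  and tanh_hyp_rad: "tanh (hyp_rad E / 2) = pseudo_ecc E (hyp_center E)"
proof -
  obtain c0 where c0: "cmod c0 < 1" "\<And>c'. cmod c' < 1 \<Longrightarrow> pseudo_ecc E c0 \<le> pseudo_ecc E c'"
    using pseudo_ecc_minimum by metis
  note eq = hyp_center_rad_eqI[OF c0]
  show "cmod (hyp_center E) < 1" using eq c0 by simp
  show "pseudo_ecc E (hyp_center E) \<le> pseudo_ecc E c" if "cmod c < 1" using eq c0 that by simp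
  show "tanh (hyp_rad E / 2) = pseudo_ecc E (hyp_center E)"
    using eq pseudo_ecc_bounds[OF c0(1)] by (simp add: tanh_artanh_real)
qed

section \<open>Behavior of the circumcenter under disk automorphisms\<close>

context
  fixes a b :: complex
  assumes ab: "cmod b < cmod a"
begin

lemma compact_disk_aut_image:
  shows "compact (disk_aut a b ` E)" "disk_aut a b ` E \<noteq> {}" "disk_aut a b ` E \<subseteq> ball 0 1"
proof -
  have "continuous_on E (disk_aut a b)"
    unfolding disk_aut_def[abs_def] using E(3) disk_aut_denom_nonzero[OF ab]
    by (auto intro!: continuous_intros)
  then show "compact (disk_aut a b ` E)" using E(1) by (rule compact_continuous_image)
  show "disk_aut a b ` E \<noteq> {}" "disk_aut a b ` E \<subseteq> ball 0 1"
    using E norm_disk_aut_less_1[OF ab] by auto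
qed

lemma pseudo_ecc_disk_aut:
  assumes "cmod c < 1"
  shows "pseudo_ecc (disk_aut a b ` E) (disk_aut a b c) = pseudo_ecc E c"
proof -
  have "pseudo_dist (disk_aut a b c) (disk_aut a b z) = pseudo_dist c z" if "z \<in> E" for z
    using pseudo_dist_disk_aut[OF ab, of c z] assms E(3) that by auto
  then show ?thesis unfolding pseudo_ecc_def image_image by (auto intro!: SUP_cong)
qed

end

end

text \<open>An automorphism preserves eccentricities and maps the disk onto itself, so every
  competing center is the image of a competing center for \<open>E\<close>.\<close>

lemma hyp_center_disk_aut:
  assumes E: "compact E" "E \<noteq> {}" "E \<subseteq> ball 0 1" and ab: "cmod b < cmod a"
  shows "hyp_center (disk_aut a b ` E) = disk_aut a b (hyp_center E)"
proof (rule hyp_center_rad_eqI)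
  note E' = compact_disk_aut_image[OF E ab]
  show "compact (disk_aut a b ` E)" "disk_aut a b ` E \<noteq> {}" "disk_aut a b ` E \<subseteq> ball 0 1"
    by (fact E')+
  show "cmod (disk_aut a b (hyp_center E)) < 1"
    by (intro norm_disk_aut_less_1 ab hyp_center_in_disk E)
  fix c assume c: "cmod c < 1"
  define d where "d = disk_aut (cnj a) (- b) c"
  have d: "cmod d < 1" "disk_aut a b d = c"
    using norm_disk_aut_less_1[of "- b" "cnj a" c] disk_aut_inverse(2)[OF ab c] ab c
    by (simp_all add: d_def)
  show "pseudo_ecc (disk_aut a b ` E) (disk_aut a b (hyp_center E)) \<le> pseudo_ecc (disk_aut a b ` E) c"
    using pseudo_ecc_hyp_center_le[OF E d(1)] pseudo_ecc_disk_aut[OF E ab d(1)]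
      pseudo_ecc_disk_aut[OF E ab hyp_center_in_disk[OF E]] by (simp add: d(2))
qed

lemma closure_disk_aut_image:
  assumes "closure X \<subseteq> ball 0 1" and ab: "cmod b < cmod a"
  shows "closure (disk_aut a b ` X) = disk_aut a b ` closure X"
proof
  have c: "continuous_on (closure X) (disk_aut a b)"
    unfolding disk_aut_def[abs_def] using assms(1) disk_aut_denom_nonzero[OF ab]
    by (auto intro!: continuous_intros)
  have "bounded (closure X)" using assms(1) bounded_subset bounded_ball by blast
  then have "compact (closure X)" by (simp add: compact_eq_bounded_closed)
  then have "closed (disk_aut a b ` closure X)"
    using c compact_continuous_image compact_imp_closed by blast
  then show "closure (disk_aut a b ` X) \<subseteq> disk_aut a b ` closure X"
    by (intro closure_minimal image_mono closure_subset)
  show "disk_aut a b ` closure X \<subseteq> closure (disk_aut a b ` X)"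
    by (intro image_closure_subset c closed_closure closure_subset)
qed

text \<open>Links the norm of a dilatation to eccentricities: a closed disk about the origin that
  contains \<open>X\<close> also contains its closure.\<close>

lemma pseudo_ecc_closure_0:
  assumes "X \<noteq> {}" "closure X \<subseteq> ball 0 1"
  shows "pseudo_ecc (closure X) 0 = (SUP z\<in>X. cmod z)"
proof (rule antisym)
  have comp: "compact (closure X)"
    using assms(2) bounded_subset bounded_ball compact_eq_bounded_closed closed_closure by blast
  have ne: "closure X \<noteq> {}" using assms(1) by simp
  have "bounded X" using assms(2) bounded_subset[OF bounded_ball[of 0 1], of X] closure_subset by blast
  then have bdd: "bdd_above (cmod ` X)"
    by (auto simp: bounded_iff intro: bdd_aboveI)
  have "X \<subseteq> cball 0 (SUP z\<in>X. cmod z)" by (auto intro!: cSUP_upper bdd)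
  then have "closure X \<subseteq> cball 0 (SUP z\<in>X. cmod z)" by (intro closure_minimal) auto
  then show "pseudo_ecc (closure X) 0 \<le> (SUP z\<in>X. cmod z)"
    using pseudo_ecc_le_iff[OF comp ne assms(2), of 0] by (auto simp: pseudo_dist_0)
  have "\<forall>z\<in>closure X. cmod z \<le> pseudo_ecc (closure X) 0"
    using pseudo_ecc_le_iff[OF comp ne assms(2), of 0 "pseudo_ecc (closure X) 0"] by (simp add: pseudo_dist_0)
  then show "(SUP z\<in>X. cmod z) \<le> pseudo_ecc (closure X) 0"
    using closure_subset by (intro cSUP_least assms(1)) blast
qed

section \<open>Harmonic mappings and their pre-Schwarzian derivatives\<close>

text \<open>An explicit pair replaces the one chosen by \<open>harmonic_parts\<close>. The
  inequality is positivity of the Jacobian and keeps \<open>deriv h\<close> free of zeros in the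
  disk.\<close>

definition sense_preserving_decomp ::
    "(complex \<Rightarrow> complex) \<Rightarrow> (complex \<Rightarrow> complex) \<Rightarrow> (complex \<Rightarrow> complex) \<Rightarrow> bool" where
  "sense_preserving_decomp f h g \<longleftrightarrow>
     harmonic_decomp f h g \<and> (\<forall>z\<in>unit_disk. cmod (deriv g z) < cmod (deriv h z))"

lemma harmonic_decomp_has_derivative:
  assumes "harmonic_decomp f h g" "z \<in> unit_disk"
  shows "(f has_derivative (\<lambda>v. deriv h z * v + cnj (deriv g z * v))) (at z)"
proof -
  have "(h has_derivative (\<lambda>v. deriv h z * v)) (at z)" "(g has_derivative (\<lambda>v. deriv g z * v)) (at z)"
    using assms holomorphic_derivI[OF _ open_ball]
    unfolding harmonic_decomp_def has_field_derivative_def[symmetric] by blast+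
  then have "((\<lambda>z. h z + cnj (g z)) has_derivative (\<lambda>v. deriv h z * v + cnj (deriv g z * v))) (at z)"
    by (intro has_derivative_add has_derivative_cnj)
  then show ?thesis
    by (rule has_derivative_transform_within_open[OF _ open_ball assms(2)])
       (use assms(1) in \<open>simp add: harmonic_decomp_def\<close>)
qed

lemma wirtinger_z_harmonic:
  assumes "harmonic_decomp f h g" "z \<in> unit_disk"
  shows "wirtinger_z f z = deriv h z"
  unfolding wirtinger_z_def frechet_derivative_at[OF harmonic_decomp_has_derivative[OF assms], symmetric]
  by (simp add: field_simps)

text \<open>\<open>deriv h\<close> is the Wirtinger derivative of \<open>f\<close>, hence determined
  by \<open>f\<close>; uniqueness of the real derivative, evaluated at 1, then determines
  \<open>deriv g\<close>.\<close>

lemma harmonic_decomp_deriv_unique: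
  assumes "harmonic_decomp f h g" "harmonic_decomp f h' g'" "z \<in> unit_disk"
  shows "deriv h z = deriv h' z" "deriv g z = deriv g' z"
proof -
  show h: "deriv h z = deriv h' z"
    using wirtinger_z_harmonic assms by metis
  have "(\<lambda>v. deriv h z * v + cnj (deriv g z * v)) = (\<lambda>v. deriv h' z * v + cnj (deriv g' z * v))"
    by (rule has_derivative_unique[OF harmonic_decomp_has_derivative harmonic_decomp_has_derivative])
       (use assms in auto)
  from fun_cong[OF this, of 1] h show "deriv g z = deriv g' z" by simp
qed

lemma harmonic_decomp_parts:
  assumes "harmonic_decomp f h g"
  shows "harmonic_decomp f (analytic_part f) (coanalytic_part f)"
  using someI[of "\<lambda>(h, g). harmonic_decomp f h g" "(h, g)"] assms
  by (simp add: analytic_part_def coanalytic_part_def harmonic_parts_def case_prod_beta)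

lemma harmonic_parts_eq:
  assumes "harmonic_decomp f h g" "z \<in> unit_disk"
  shows "dilatation f z = deriv g z / deriv h z"
    and "jacobian f z = (cmod (deriv h z))\<^sup>2 - (cmod (deriv g z))\<^sup>2"
  using harmonic_decomp_deriv_unique[OF harmonic_decomp_parts[OF assms(1)] assms]
  by (simp_all add: dilatation_def jacobian_def)

lemma op_harmonic_iff: "op_harmonic f \<longleftrightarrow> (\<exists>h g. sense_preserving_decomp f h g)"
proof -
  have *: "(\<forall>z\<in>unit_disk. jacobian f z > 0) \<longleftrightarrow> (\<forall>z\<in>unit_disk. cmod (deriv g z) < cmod (deriv h z))"
    if "harmonic_decomp f h g" for h g
    using harmonic_parts_eq(2)[OF that]
    by (metis diff_gt_0_iff_gt norm_ge_zero power2_less_imp_less power_strict_mono zero_less_numeral)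
  then show ?thesis unfolding op_harmonic_def sense_preserving_decomp_def by blast
qed

lemma sense_preserving_decompD:
  assumes "sense_preserving_decomp f h g"
  shows "harmonic_decomp f h g" "h holomorphic_on unit_disk" "g holomorphic_on unit_disk"
    and "z \<in> unit_disk \<Longrightarrow> cmod (deriv g z) < cmod (deriv h z)"
    and "z \<in> unit_disk \<Longrightarrow> deriv h z \<noteq> 0"
proof -
  show "harmonic_decomp f h g" "h holomorphic_on unit_disk" "g holomorphic_on unit_disk"
    and less: "z \<in> unit_disk \<Longrightarrow> cmod (deriv g z) < cmod (deriv h z)"
    using assms by (auto simp: sense_preserving_decomp_def harmonic_decomp_def)
  show "z \<in> unit_disk \<Longrightarrow> deriv h z \<noteq> 0"
    using less by (metis norm_not_less_zero norm_zero)
qed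

text \<open>The derivative of log J is J_z / J, and conjugates of analytic functions have vanishing
  z-derivative. The numerator is left as the Hermitian product of (h'', g'') with (h', g'), the form
  that makes affine invariance visible.\<close>

lemma pre_schwarzian_eq:
  assumes f: "sense_preserving_decomp f h g" and z: "z \<in> unit_disk"
  shows "pre_schwarzian f z =
    (cnj (deriv h z) * deriv (deriv h) z - cnj (deriv g z) * deriv (deriv g) z)
      / of_real ((cmod (deriv h z))\<^sup>2 - (cmod (deriv g z))\<^sup>2)"
proof -
  define J where "J = (cmod (deriv h z))\<^sup>2 - (cmod (deriv g z))\<^sup>2"
  note f' = sense_preserving_decompD[OF f]
  have J: "J > 0" using f'(4)[OF z] by (simp add: J_def power_strict_mono)
  \<comment> \<open>The squared modulus is only real differentiable, so it is treated as the inner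
    product of \<open>deriv u\<close> with itself.\<close>
  have sq: "((\<lambda>z. (cmod (deriv u z))\<^sup>2) has_derivative
      (\<lambda>v. 2 * (deriv u z \<bullet> (deriv (deriv u) z * v)))) (at z)"
    if "u holomorphic_on unit_disk" for u
  proof -
    have "(deriv u has_derivative (\<lambda>v. deriv (deriv u) z * v)) (at z)"
      using holomorphic_derivI[OF holomorphic_deriv[OF that open_ball] open_ball z]
      unfolding has_field_derivative_def .
    from has_derivative_inner[OF this this] show ?thesis
      by (simp add: power2_norm_eq_inner inner_commute)
  qed
  define D where "D v = (2 * (deriv h z \<bullet> (deriv (deriv h) z * v))
      - 2 * (deriv g z \<bullet> (deriv (deriv g) z * v))) / J" for v
  have dJ: "((\<lambda>z. (cmod (deriv h z))\<^sup>2 - (cmod (deriv g z))\<^sup>2) has_derivative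
      (\<lambda>v. 2 * (deriv h z \<bullet> (deriv (deriv h) z * v)) - 2 * (deriv g z \<bullet> (deriv (deriv g) z * v)))) (at z)"
    by (intro has_derivative_diff sq f'(2,3))
  have "((\<lambda>z. ln ((cmod (deriv h z))\<^sup>2 - (cmod (deriv g z))\<^sup>2)) has_derivative D) (at z)"
    using has_derivative_ln[OF _ dJ] J by (simp add: D_def[abs_def] J_def divide_inverse mult.commute)
  then have "((\<lambda>z. complex_of_real (ln ((cmod (deriv h z))\<^sup>2 - (cmod (deriv g z))\<^sup>2)))
      has_derivative (\<lambda>v. of_real (D v))) (at z)"
    by (rule has_derivative_of_real)
  then have "((\<lambda>z. complex_of_real (ln (jacobian f z))) has_derivative (\<lambda>v. of_real (D v))) (at z)"
    by (rule has_derivative_transform_within_open[OF _ open_ball z])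
       (simp add: harmonic_parts_eq(2)[OF f'(1)])
  note frechet_derivative_at[OF this, symmetric]
  then have "pre_schwarzian f z = (of_real (D 1) - \<i> * of_real (D \<i>)) / 2"
    by (simp add: pre_schwarzian_def wirtinger_z_def)
  also have "\<dots> = (cnj (deriv h z) * deriv (deriv h) z - cnj (deriv g z) * deriv (deriv g) z) / of_real J"
    using J by (simp add: D_def complex_eq_iff inner_complex_def field_simps)
  finally show ?thesis by (simp only: J_def)
qed

text \<open>The pair (h', g') goes to (a h' + b g', cnj b h' + cnj a g'), a linear map that
  multiplies the form |p|^2 - |q|^2 and its polarization by |a|^2 - |b|^2. The factor cancels in the
  pre-Schwarzian derivative, and the quotient of the components gives the automorphism.\<close>

lemma sense_preserving_affine:
  fixes c :: complex
  assumes f: "sense_preserving_decomp f h g" and ab: "cmod b < cmod a"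
  defines "F \<equiv> \<lambda>z. a * f z + b * cnj (f z) + c"
    and "H \<equiv> \<lambda>z. a * h z + b * g z + c" and "G \<equiv> \<lambda>z. cnj a * g z + cnj b * h z"
  shows "sense_preserving_decomp F H G"
    and "z \<in> unit_disk \<Longrightarrow> dilatation F z = disk_aut a b (dilatation f z)"
    and "z \<in> unit_disk \<Longrightarrow> pre_schwarzian F z = pre_schwarzian f z"
proof -
  note f' = sense_preserving_decompD[OF f]
  have dc: "harmonic_decomp F H G"
    using f'(1-3) unfolding harmonic_decomp_def F_def H_def G_def
    by (auto intro!: holomorphic_intros simp: algebra_simps)
  have dh: "(h has_field_derivative deriv h z) (at z)" "(g has_field_derivative deriv g z) (at z)"
    "(deriv h has_field_derivative deriv (deriv h) z) (at z)"
    "(deriv g has_field_derivative deriv (deriv g) z) (at z)" if "z \<in> unit_disk" for z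
    using that f'(2,3) by (auto intro!: holomorphic_derivI[of _ unit_disk] holomorphic_deriv)
  have d: "deriv H z = a * deriv h z + b * deriv g z" "deriv G z = cnj a * deriv g z + cnj b * deriv h z"
    if "z \<in> unit_disk" for z
    unfolding H_def G_def using dh[OF that]
    by (auto intro!: DERIV_imp_deriv derivative_eq_intros)
  have d2: "deriv (deriv H) z = a * deriv (deriv h) z + b * deriv (deriv g) z"
      "deriv (deriv G) z = cnj a * deriv (deriv g) z + cnj b * deriv (deriv h) z"
    if z: "z \<in> unit_disk" for z
  proof -
    have "deriv (deriv H) z = deriv (\<lambda>z. a * deriv h z + b * deriv g z) z"
      "deriv (deriv G) z = deriv (\<lambda>z. cnj a * deriv g z + cnj b * deriv h z) z"
      using z d by (auto intro!: deriv_cong_ev eventually_nhds_in_open[of unit_disk, THEN eventually_mono])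
    moreover have "deriv (\<lambda>z. a * deriv h z + b * deriv g z) z = a * deriv (deriv h) z + b * deriv (deriv g) z"
      "deriv (\<lambda>z. cnj a * deriv g z + cnj b * deriv h z) z = cnj a * deriv (deriv g) z + cnj b * deriv (deriv h) z"
      using dh[OF z] by (auto intro!: DERIV_imp_deriv derivative_eq_intros)
    ultimately show "deriv (deriv H) z = a * deriv (deriv h) z + b * deriv (deriv g) z"
      "deriv (deriv G) z = cnj a * deriv (deriv g) z + cnj b * deriv (deriv h) z" by simp_all
  qed
  have jac: "(cmod (deriv H z))\<^sup>2 - (cmod (deriv G z))\<^sup>2
      = ((cmod a)\<^sup>2 - (cmod b)\<^sup>2) * ((cmod (deriv h z))\<^sup>2 - (cmod (deriv g z))\<^sup>2)"
    if z: "z \<in> unit_disk" for z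
  proof -
    have "complex_of_real ((cmod (deriv H z))\<^sup>2 - (cmod (deriv G z))\<^sup>2)
        = of_real (((cmod a)\<^sup>2 - (cmod b)\<^sup>2) * ((cmod (deriv h z))\<^sup>2 - (cmod (deriv g z))\<^sup>2))"
      by (simp add: d[OF z] complex_norm_square algebra_simps flip: of_real_power)
    then show ?thesis by (simp only: of_real_eq_iff)
  qed
  have ab2: "0 < (cmod a)\<^sup>2 - (cmod b)\<^sup>2" using ab by (simp add: power_strict_mono)
  show F: "sense_preserving_decomp F H G"
    unfolding sense_preserving_decomp_def
  proof (intro conjI dc ballI)
    fix z assume z: "z \<in> unit_disk"
    have "0 < (cmod (deriv h z))\<^sup>2 - (cmod (deriv g z))\<^sup>2"
      using f'(4)[OF z] by (simp add: power_strict_mono)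
    then have "0 < (cmod (deriv H z))\<^sup>2 - (cmod (deriv G z))\<^sup>2"
      unfolding jac[OF z] using ab2 by simp
    then have "(cmod (deriv G z))\<^sup>2 < (cmod (deriv H z))\<^sup>2" by simp
    then show "cmod (deriv G z) < cmod (deriv H z)" by (rule power_less_imp_less_base) simp
  qed
  show "dilatation F z = disk_aut a b (dilatation f z)" if z: "z \<in> unit_disk"
  proof -
    have "cnj a * (deriv g z / deriv h z) + cnj b = deriv G z / deriv h z"
      "a + b * (deriv g z / deriv h z) = deriv H z / deriv h z"
      using f'(5)[OF z] by (simp_all add: d[OF z] field_simps)
    then show ?thesis
      using f'(5)[OF z]
      by (simp add: harmonic_parts_eq(1)[OF dc z] harmonic_parts_eq(1)[OF f'(1) z] disk_aut_def)
  qed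
  show "pre_schwarzian F z = pre_schwarzian f z" if z: "z \<in> unit_disk"
  proof -
    have "cnj (deriv H z) * deriv (deriv H) z - cnj (deriv G z) * deriv (deriv G) z
      = of_real ((cmod a)\<^sup>2 - (cmod b)\<^sup>2) *
        (cnj (deriv h z) * deriv (deriv h) z - cnj (deriv g z) * deriv (deriv g) z)"
      by (simp add: d[OF z] d2[OF z] complex_norm_square algebra_simps flip: of_real_power)
    moreover have "complex_of_real ((cmod a)\<^sup>2 - (cmod b)\<^sup>2) \<noteq> 0"
      using ab2 by (simp only: of_real_eq_0_iff)
    ultimately show ?thesis
      unfolding pre_schwarzian_eq[OF F z] pre_schwarzian_eq[OF f z] jac[OF z] of_real_mult
      by (simp del: of_real_diff)
  qed
qed

text \<open>For the last claim, with p = h' and q = g', both fractions are put over p (|p|^2 -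
  |q|^2). The terms |p|^2 p' cancel and leave cnj q (q' p - q p'), which contains the numerator of
  the derivative of q / p.\<close>

lemma sense_preserving_decomp_dilatation:
  assumes f: "sense_preserving_decomp f h g"
  shows "dilatation f holomorphic_on unit_disk"
    and "z \<in> unit_disk \<Longrightarrow> cmod (dilatation f z) < 1"
    and "z \<in> unit_disk \<Longrightarrow> analytic_pre_schwarzian h z - pre_schwarzian f z
      = cnj (dilatation f z) * deriv (dilatation f) z / of_real (1 - (cmod (dilatation f z))\<^sup>2)"
proof -
  note f' = sense_preserving_decompD[OF f]
  have "(\<lambda>z. deriv g z / deriv h z) holomorphic_on unit_disk"
    using f' by (intro holomorphic_intros) auto
  then show hol: "dilatation f holomorphic_on unit_disk"
    by (rule holomorphic_transform) (simp add: harmonic_parts_eq(1)[OF f'(1)])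
  show "cmod (dilatation f z) < 1" if z: "z \<in> unit_disk"
    using f'(4,5)[OF z] by (simp add: harmonic_parts_eq(1)[OF f'(1) z] norm_divide)
  show "analytic_pre_schwarzian h z - pre_schwarzian f z
      = cnj (dilatation f z) * deriv (dilatation f) z / of_real (1 - (cmod (dilatation f z))\<^sup>2)"
    if z: "z \<in> unit_disk"
  proof -
    define p p' q q' where "p = deriv h z" "p' = deriv (deriv h) z" "q = deriv g z" "q' = deriv (deriv g) z"
    note [simp] = p_p'_q_q'_def[symmetric]
    have p0: "p \<noteq> 0" using f'(5)[OF z] by simp
    have "cmod q < cmod p" using f'(4)[OF z] by simp
    then have "(cmod q)\<^sup>2 < (cmod p)\<^sup>2" by (simp add: power_strict_mono)
    then have "complex_of_real ((cmod p)\<^sup>2 - (cmod q)\<^sup>2) \<noteq> 0" by (simp only: of_real_eq_0_iff)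
    then have J0: "p * cnj p - q * cnj q \<noteq> 0" by (simp add: complex_norm_square flip: of_real_power)
    have "(deriv h has_field_derivative p') (at z)" "(deriv g has_field_derivative q') (at z)"
      using holomorphic_derivI[OF holomorphic_deriv[OF f'(2) open_ball] open_ball z]
        holomorphic_derivI[OF holomorphic_deriv[OF f'(3) open_ball] open_ball z] by simp_all
    then have "((\<lambda>z. deriv g z / deriv h z) has_field_derivative (q' * p - q * p') / (p * p)) (at z)"
      using DERIV_divide[of "deriv g" q' z UNIV "deriv h" p'] p0 by simp
    then have "(dilatation f has_field_derivative (q' * p - q * p') / (p * p)) (at z)"
      by (rule has_field_derivative_transform_within_open[OF _ open_ball z])
         (simp add: harmonic_parts_eq(1)[OF f'(1)])
    then have d: "deriv (dilatation f) z = (q' * p - q * p') / (p * p)" by (rule DERIV_imp_deriv)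
    have w: "dilatation f z = q / p" by (simp add: harmonic_parts_eq(1)[OF f'(1) z])
    have "complex_of_real (1 - (cmod (q / p))\<^sup>2) = (p * cnj p - q * cnj q) / (p * cnj p)"
      using p0 by (simp add: complex_norm_square divide_simps flip: of_real_power)
    moreover have "analytic_pre_schwarzian h z - pre_schwarzian f z
        = p' / p - (cnj p * p' - cnj q * q') / (p * cnj p - q * cnj q)"
      by (simp add: pre_schwarzian_eq[OF f z] analytic_pre_schwarzian_def complex_norm_square flip: of_real_power)
    moreover have "p' / p - (cnj p * p' - cnj q * q') / (p * cnj p - q * cnj q)
       = cnj (q / p) * ((q' * p - q * p') / (p * p)) / ((p * cnj p - q * cnj q) / (p * cnj p))"
    proof -
      have "p' / p - (cnj p * p' - cnj q * q') / (p * cnj p - q * cnj q)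
        = (cnj q * (q' * p - q * p')) / (p * (p * cnj p - q * cnj q))"
        using p0 J0 by (subst diff_frac_eq) (auto simp: algebra_simps)
      then show ?thesis using p0 by simp
    qed
    ultimately show ?thesis by (simp only: w d)
  qed
qed

section \<open>The extremal constant\<close>

text \<open>The smaller root of x^2 - (3 - k^2) x + k^2, whose discriminant (3 - k^2)^2 - 4 k^2
  factors as (1 - k^2) (9 - k^2).\<close>

definition x_root :: "real \<Rightarrow> real" where
  "x_root k = (3 - k\<^sup>2 - sqrt ((1 - k\<^sup>2) * (9 - k\<^sup>2))) / 2"

text \<open>The upper bound k^2 later places the extremal point sqrt (x_root k) / k inside the
  disk.\<close>

lemma x_root:
  assumes "0 < k" "k < 1"
  shows "0 < x_root k" "x_root k < k\<^sup>2" "(x_root k)\<^sup>2 - (3 - k\<^sup>2) * x_root k + k\<^sup>2 = 0"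
proof -
  define q where "q = sqrt ((1 - k\<^sup>2) * (9 - k\<^sup>2))"
  have k2: "0 < k\<^sup>2" "k\<^sup>2 < 1" using assms by (simp_all add: abs_square_less_1)
  have q2: "q\<^sup>2 = (1 - k\<^sup>2) * (9 - k\<^sup>2)" using k2 by (simp add: q_def)
  have x: "x_root k = (3 - k\<^sup>2 - q) / 2" by (simp add: x_root_def q_def)
  have "q < 3 - k\<^sup>2"
    unfolding q_def using k2 by (intro real_less_lsqrt) (auto simp: power2_eq_square algebra_simps)
  then show "0 < x_root k" by (simp add: x)
  have "(1 - k\<^sup>2) * (9 * (1 - k\<^sup>2)) < (1 - k\<^sup>2) * (9 - k\<^sup>2)"
    using k2 by (intro mult_strict_left_mono) auto
  then have "3 * (1 - k\<^sup>2) < q"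
    unfolding q_def by (intro real_less_rsqrt) (simp add: power2_eq_square algebra_simps)
  then show "x_root k < k\<^sup>2" by (simp add: x)
  show "(x_root k)\<^sup>2 - (3 - k\<^sup>2) * x_root k + k\<^sup>2 = 0"
    using q2 unfolding x by (simp add: power2_eq_square field_simps)
qed

lemma powr_three_halves:
  fixes x :: real
  assumes "0 < x"
  shows "x powr (3 / 2) = x * sqrt x"
proof -
  have "x powr (3 / 2) = x powr (1 + 1 / 2)" by simp
  also have "\<dots> = x powr 1 * x powr (1 / 2)" by (rule powr_add)
  also have "\<dots> = x * sqrt x" using assms by (simp only: powr_one powr_half_sqrt less_imp_le)
  finally show ?thesis .
qed

text \<open>After cancelling sqrt x / k, cross-multiplication gives (k^2 - x) (1 + x) = 2 x (1 - x),
  a rearrangement of the quadratic.\<close>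

lemma extremal_eq_iff:
  assumes "0 < k" "0 < x" "x < 1"
  shows "extremal_eq k x \<longleftrightarrow> x\<^sup>2 - (3 - k\<^sup>2) * x + k\<^sup>2 = 0"
proof -
  have "extremal_eq k x \<longleftrightarrow> (sqrt x / k) * ((k\<^sup>2 - x) / (1 - x)) = (sqrt x / k) * (2 * x / (1 + x))"
    using assms by (simp add: extremal_eq_def powr_three_halves mult_ac)
  also have "\<dots> \<longleftrightarrow> (k\<^sup>2 - x) / (1 - x) = 2 * x / (1 + x)"
    using assms by (subst mult_cancel_left) auto
  also have "\<dots> \<longleftrightarrow> (k\<^sup>2 - x) * (1 + x) = 2 * x * (1 - x)"
    using assms by (subst frac_eq_eq) auto
  also have "\<dots> \<longleftrightarrow> x\<^sup>2 - (3 - k\<^sup>2) * x + k\<^sup>2 = 0"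
    by (auto simp: power2_eq_square algebra_simps)
  finally show ?thesis .
qed

text \<open>The roots of \<open>x\<^sup>2 - (3 - k\<^sup>2) x + k\<^sup>2\<close> add up to \<open>3 - k\<^sup>2 > 2\<close>, so at most one lies in \<open>(0, 1)\<close>.\<close>

lemma extremal_eq_unique:
  assumes k: "0 < k" "k < 1" and x: "0 < x" "x < 1" "extremal_eq k x"
  shows "x = x_root k"
proof (rule ccontr)
  assume ne: "x \<noteq> x_root k"
  have k2: "k\<^sup>2 < 1" using k by (simp add: abs_square_less_1)
  have "(x - x_root k) * (x + x_root k - (3 - k\<^sup>2)) = 0"
    using x_root(3)[OF k] x extremal_eq_iff[OF k(1) x(1,2)]
    by (simp add: power2_eq_square algebra_simps)
  then have "x + x_root k = 3 - k\<^sup>2" using ne by simp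
  then show False using x(2) x_root(2)[OF k] k2 by simp
qed

lemma x_root_extremal:
  assumes "0 < k" "k < 1"
  shows "x_root k < 1" "extremal_eq k (x_root k)"
proof -
  have "k\<^sup>2 < 1" using assms by (simp add: abs_square_less_1)
  then show "x_root k < 1" using x_root(2)[OF assms] by simp
  then show "extremal_eq k (x_root k)"
    using extremal_eq_iff[OF assms(1)] x_root[OF assms] by simp
qed

lemma x_sol_eq:
  assumes "0 < k" "k < 1"
  shows "x_sol k = x_root k"
  unfolding x_sol_def
proof (rule the_equality)
  show "0 < x_root k \<and> x_root k < 1 \<and> extremal_eq k (x_root k)"
    using x_root(1)[OF assms] x_root_extremal[OF assms] by blast
  show "x = x_root k" if "0 < x \<and> x < 1 \<and> extremal_eq k x" for x
    using extremal_eq_unique[OF assms] that by blast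
qed

lemma C_bound_eq:
  assumes "0 < k" "k < 1"
  shows "C_bound k = sqrt (x_root k) * (k\<^sup>2 - x_root k) / (k * (1 - x_root k))"
    and "C_bound k = 2 * x_root k powr (3 / 2) / (k * (1 + x_root k))"
    and "C_bound k = 2 * sqrt (x_root k) ^ 3 / (k * (1 + (sqrt (x_root k))\<^sup>2))"
proof -
  show 1: "C_bound k = sqrt (x_root k) * (k\<^sup>2 - x_root k) / (k * (1 - x_root k))"
    using assms by (simp add: C_bound_def x_sol_eq)
  then show 2: "C_bound k = 2 * x_root k powr (3 / 2) / (k * (1 + x_root k))"
    using x_root_extremal(2)[OF assms] by (simp add: extremal_eq_def)
  show "C_bound k = 2 * sqrt (x_root k) ^ 3 / (k * (1 + (sqrt (x_root k))\<^sup>2))"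
    using x_root(1)[OF assms] by (simp add: 2 powr_three_halves power3_eq_cube)
qed

lemma C_bound_maximum:
  assumes k: "0 < k" "k < 1" and t: "0 \<le> t" "t \<le> k"
  shows "t * (k\<^sup>2 - t\<^sup>2) / (k * (1 - t\<^sup>2)) \<le> C_bound k"
proof -
  define s where "s = sqrt (x_root k)"
  have s: "s\<^sup>2 = x_root k" "0 < s" using x_root(1)[OF k] by (simp_all add: s_def)
  have t2: "t\<^sup>2 < 1" using t k by (simp add: abs_square_less_1)
  \<comment> \<open>The quadratic satisfied by s^2 eliminates k from the difference, leaving a
    polynomial in s and t.\<close>
  have k2: "k\<^sup>2 * (1 + s\<^sup>2) = 3 * s\<^sup>2 - s ^ 4"
    using x_root(3)[OF k] unfolding s(1)[symmetric] by (simp add: algebra_simps flip: power_mult)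
  \<comment> \<open>The maximum at \<open>t = s\<close> shows as a double root of the cross-multiplied difference.\<close>
  have "0 \<le> (t - s)\<^sup>2 * ((1 + s\<^sup>2) * t + 2 * s)"
    using s(2) t by (intro mult_nonneg_nonneg add_nonneg_nonneg) auto
  also have "\<dots> = 2 * s ^ 3 * (1 - t\<^sup>2) - (t * (k\<^sup>2 * (1 + s\<^sup>2)) - t ^ 3 * (1 + s\<^sup>2))"
    unfolding k2 by (simp add: algebra_simps power2_eq_square power3_eq_cube power4_eq_xxxx)
  finally have "t * (k\<^sup>2 - t\<^sup>2) * (1 + s\<^sup>2) \<le> 2 * s ^ 3 * (1 - t\<^sup>2)"
    by (simp add: algebra_simps power2_eq_square power3_eq_cube)
  moreover have "0 < 1 + s\<^sup>2" by (simp add: add_pos_nonneg)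
  ultimately have "t * (k\<^sup>2 - t\<^sup>2) / (1 - t\<^sup>2) \<le> 2 * s ^ 3 / (1 + s\<^sup>2)"
    using t2 by (simp add: divide_le_eq pos_le_divide_eq)
  then have "t * (k\<^sup>2 - t\<^sup>2) / (1 - t\<^sup>2) / k \<le> 2 * s ^ 3 / (1 + s\<^sup>2) / k"
    using k by (intro divide_right_mono) auto
  then show ?thesis by (simp add: C_bound_eq(3)[OF k] flip: s_def) (simp add: mult.commute)
qed

text \<open>In the scaled variable u = sqrt (x_root k) / k the constant is 2 k^2 u^3 / (1 + k^2
  u^2), and the quadratic reads 3 u^2 = 1 + k^2 (u^2 + u^4), so u is within O(k^2) of u0 = 1 / sqrt
  3. The 6 arises as 2 k^2 times 3 k^2: a share 2 k^2 from u^3 - u0^3 and k^2 from the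
  denominator.\<close>

lemma C_bound_asymptotics:
  "(\<lambda>k. C_bound k - 2 / (3 * sqrt 3) * k\<^sup>2) \<in> O[at_right 0](\<lambda>k. k ^ 4)"
proof (rule bigoI[of _ 6])
  have "\<bar>C_bound k - 2 / (3 * sqrt 3) * k\<^sup>2\<bar> \<le> 6 * k ^ 4" if k: "0 < k" "k < 1" for k
  proof -
    define u where "u = sqrt (x_root k) / k"
    define u0 where "u0 = 1 / sqrt (3::real)"
    have u: "0 < u" "u\<^sup>2 = x_root k / k\<^sup>2"
      using x_root(1)[OF k] k by (simp_all add: u_def power_divide)
    have X: "x_root k = k\<^sup>2 * u\<^sup>2" using u k by simp
    have k2: "0 < k\<^sup>2" "k\<^sup>2 < 1" using k by (simp_all add: abs_square_less_1)
    have u1: "u\<^sup>2 < 1" using x_root(2)[OF k] u k2 by simp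
    have "k\<^sup>2 * (k\<^sup>2 * (u\<^sup>2)\<^sup>2 - (3 - k\<^sup>2) * u\<^sup>2 + 1) = 0"
      using x_root(3)[OF k] unfolding X by (simp add: algebra_simps power2_eq_square)
    then have "k\<^sup>2 * (u\<^sup>2)\<^sup>2 - (3 - k\<^sup>2) * u\<^sup>2 + 1 = 0" using k2(1) by simp
    then have quad: "3 * u\<^sup>2 = 1 + k\<^sup>2 * (u\<^sup>2 + (u\<^sup>2)\<^sup>2)" by (simp add: algebra_simps)
    have "(u\<^sup>2)\<^sup>2 \<le> 1" using u1 power_le_one[of "u\<^sup>2" 2] by simp
    then have "k\<^sup>2 * (u\<^sup>2 + (u\<^sup>2)\<^sup>2) \<le> k\<^sup>2 * 2" using u1 k2 by (intro mult_left_mono) auto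
    moreover have "0 \<le> k\<^sup>2 * (u\<^sup>2 + (u\<^sup>2)\<^sup>2)" by (intro mult_nonneg_nonneg add_nonneg_nonneg) auto
    moreover have "u0\<^sup>2 = 1 / 3" by (simp add: u0_def power_divide)
    ultimately have du: "u\<^sup>2 - u0\<^sup>2 \<le> 2 / 3 * k\<^sup>2" "u0\<^sup>2 \<le> u\<^sup>2" using quad by linarith+
    have "sqrt 3 \<le> (2::real)" by (rule real_le_lsqrt) auto
    moreover have "1 \<le> sqrt (3::real)" by simp
    ultimately have u0: "1 / 2 \<le> u0" "u0 \<le> 1" unfolding u0_def by (auto simp: divide_simps)
    have ub: "u0 \<le> u" "u \<le> 1"
      using du(2) u u1 power2_le_imp_le[of u0 u] power2_le_imp_le[of u 1] by simp_all
    \<comment> \<open>Both u and u0 are at least 1/2, so u + u0 is at least 1 and the estimate of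
      u^2 - u0^2 bounds u - u0.\<close>
    have "(u - u0) * 1 \<le> (u - u0) * (u + u0)" using ub u0 by (intro mult_left_mono) auto
    then have duu: "u - u0 \<le> 2 / 3 * k\<^sup>2" using du by (simp add: algebra_simps power2_eq_square)
    have "u ^ 3 - u0 ^ 3 = (u - u0) * (u\<^sup>2 + u * u0 + u0\<^sup>2)"
      by (simp add: algebra_simps power2_eq_square power3_eq_cube)
    also have "\<dots> \<le> (2 / 3 * k\<^sup>2) * 3"
    proof (intro mult_mono duu)
      have "u * u0 \<le> 1" using ub u0 by (intro mult_le_one) auto
      then show "u\<^sup>2 + u * u0 + u0\<^sup>2 \<le> 3" using u1 du(2) by simp
    qed (use ub u0 k2 in auto)
    finally have cube: "u ^ 3 - u0 ^ 3 \<le> 2 * k\<^sup>2" by simp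
    have cube0: "0 \<le> u ^ 3 - u0 ^ 3" using ub u0 by (simp add: power_mono)
    define d where "d = 1 + k\<^sup>2 * u\<^sup>2"
    have d: "1 \<le> d" by (simp add: d_def)
    have "k * u = sqrt (x_root k)" using k by (simp add: u_def)
    then have "C_bound k = 2 * (k * u) ^ 3 / (k * (1 + (k * u)\<^sup>2))" by (simp only: C_bound_eq(3)[OF k])
    also have "\<dots> = 2 * k\<^sup>2 * u ^ 3 / d"
      using k by (simp add: d_def power_mult_distrib power2_eq_square power3_eq_cube mult_ac)
    finally have C: "C_bound k = 2 * k\<^sup>2 * u ^ 3 / d" .
    have c0: "2 / (3 * sqrt 3) = 2 * u0 ^ 3"
      by (simp add: u0_def power_divide power3_eq_cube)
    have "C_bound k - 2 / (3 * sqrt 3) * k\<^sup>2 = (2 * k\<^sup>2 * u ^ 3 - 2 * u0 ^ 3 * k\<^sup>2 * d) / d"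
      unfolding C c0 using d by (simp add: diff_divide_distrib)
    also have "2 * k\<^sup>2 * u ^ 3 - 2 * u0 ^ 3 * k\<^sup>2 * d
        = 2 * k\<^sup>2 * ((u ^ 3 - u0 ^ 3) - k\<^sup>2 * (u\<^sup>2 * u0 ^ 3))"
      by (simp add: d_def algebra_simps)
    finally have "\<bar>C_bound k - 2 / (3 * sqrt 3) * k\<^sup>2\<bar>
        = 2 * k\<^sup>2 * \<bar>(u ^ 3 - u0 ^ 3) - k\<^sup>2 * (u\<^sup>2 * u0 ^ 3)\<bar> / d"
      using d by (simp add: abs_mult)
    also have "\<dots> \<le> 2 * k\<^sup>2 * \<bar>(u ^ 3 - u0 ^ 3) - k\<^sup>2 * (u\<^sup>2 * u0 ^ 3)\<bar> / 1"
      using d by (intro divide_left_mono) auto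
    also have "\<dots> \<le> 2 * k\<^sup>2 * (3 * k\<^sup>2)"
    proof -
      have uu: "u\<^sup>2 * u0 ^ 3 \<le> 1" "0 \<le> u\<^sup>2 * u0 ^ 3"
        using ub u(1) u0 by (auto intro!: mult_le_one power_le_one)
      have "k\<^sup>2 * (u\<^sup>2 * u0 ^ 3) \<le> k\<^sup>2"
        using mult_left_mono[OF uu(1), of "k\<^sup>2"] by simp
      moreover have "0 \<le> k\<^sup>2 * (u\<^sup>2 * u0 ^ 3)" by (intro mult_nonneg_nonneg[OF _ uu(2)]) simp
      ultimately have "\<bar>(u ^ 3 - u0 ^ 3) - k\<^sup>2 * (u\<^sup>2 * u0 ^ 3)\<bar> \<le> 3 * k\<^sup>2"
        using cube cube0 k2 by linarith
      then show ?thesis unfolding div_by_1 by (intro mult_left_mono) auto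
    qed
    also have "\<dots> = 6 * k ^ 4" by (simp add: power2_eq_square power4_eq_xxxx)
    finally show ?thesis .
  qed
  then show "\<forall>\<^sub>F k in at_right 0. norm (C_bound k - 2 / (3 * sqrt 3) * k\<^sup>2) \<le> 6 * norm (k ^ 4)"
    unfolding eventually_at_right_field real_norm_def by (intro exI[of _ 1]) fastforce
qed

section \<open>The sharp estimate\<close>

lemma disk_aut_holomorphic: "cmod b < cmod a \<Longrightarrow> disk_aut a b holomorphic_on unit_disk"
  unfolding holomorphic_on_open[OF open_ball]
  by (metis has_field_derivative_disk_aut less_imp_le mem_ball_0)

lemma Schwarz_Pick:
  assumes f: "f holomorphic_on unit_disk" "\<And>z. cmod z < 1 \<Longrightarrow> cmod (f z) < 1" and z: "cmod z < 1"
  shows "(1 - (cmod z)\<^sup>2) * cmod (deriv f z) \<le> 1 - (cmod (f z))\<^sup>2"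
proof -
  define w where "w = f z"
  have w: "cmod w < 1" using f(2) z by (simp add: w_def)
  \<comment> \<open>The inner automorphism takes 0 to \<open>z\<close>, the outer one takes
    \<open>f z\<close> to 0; the Schwarz lemma applies, and the chain rule supplies the
    weights.\<close>
  define g where "g = disk_aut 1 (- cnj w) \<circ> (f \<circ> disk_aut 1 (cnj z))"
  have aut_z0: "disk_aut 1 (cnj z) 0 = z" by (simp add: disk_aut_def)
  have "g holomorphic_on unit_disk"
    unfolding g_def using w z f(2) norm_disk_aut_less_1[of "cnj z" 1]
    by (intro holomorphic_on_compose_gen[where t = unit_disk] f(1) disk_aut_holomorphic) auto
  moreover have "g 0 = 0" by (simp add: g_def aut_z0 flip: w_def) (simp add: disk_aut_def)
  moreover have "cmod (g \<zeta>) < 1" if "cmod \<zeta> < 1" for \<zeta>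
    using that w z f(2) by (simp add: g_def norm_disk_aut_less_1)
  ultimately have g1: "cmod (deriv g 0) \<le> 1" using Schwarz_Lemma(2)[of g 0] by simp
  have "(disk_aut 1 (cnj z) has_field_derivative of_real (1 - (cmod z)\<^sup>2)) (at 0)"
    using has_field_derivative_disk_aut[of "cnj z" 1 0] z by simp
  moreover have "(f has_field_derivative deriv f z) (at (disk_aut 1 (cnj z) 0))"
    using holomorphic_derivI[OF f(1) open_ball, of z] z by (simp add: aut_z0)
  ultimately have "(f \<circ> disk_aut 1 (cnj z) has_field_derivative deriv f z * of_real (1 - (cmod z)\<^sup>2)) (at 0)"
    by (rule DERIV_chain[rotated])
  moreover have "(disk_aut 1 (- cnj w) has_field_derivative
      of_real (1 - (cmod w)\<^sup>2) / (1 - cnj w * w)\<^sup>2) (at ((f \<circ> disk_aut 1 (cnj z)) 0))"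
    using has_field_derivative_disk_aut[of "- cnj w" 1 w] w by (simp add: aut_z0 flip: w_def)
  ultimately have "(g has_field_derivative of_real (1 - (cmod w)\<^sup>2) / (1 - cnj w * w)\<^sup>2
      * (deriv f z * of_real (1 - (cmod z)\<^sup>2))) (at 0)"
    unfolding g_def by (rule DERIV_chain[rotated])
  then have d: "deriv g 0 = of_real (1 - (cmod w)\<^sup>2) / (1 - cnj w * w)\<^sup>2
      * (deriv f z * of_real (1 - (cmod z)\<^sup>2))"
    by (rule DERIV_imp_deriv)
  have pos: "0 < 1 - (cmod w)\<^sup>2" "0 < 1 - (cmod z)\<^sup>2" using w z by (simp_all add: abs_square_less_1)
  have ww: "1 - cnj w * w = of_real (1 - (cmod w)\<^sup>2)"
    by (simp add: complex_norm_square mult.commute flip: of_real_power)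
  have "cmod (deriv g 0) = (1 - (cmod w)\<^sup>2) / (1 - (cmod w)\<^sup>2)\<^sup>2 * (cmod (deriv f z) * (1 - (cmod z)\<^sup>2))"
    using pos unfolding d ww norm_mult norm_divide norm_power norm_of_real by simp
  also have "\<dots> = (1 - (cmod z)\<^sup>2) * cmod (deriv f z) / (1 - (cmod w)\<^sup>2)"
    using pos(1) by (simp add: power2_eq_square[of "1 - _"])
  finally show ?thesis using g1 pos(1) by (simp add: w_def divide_le_eq)
qed

text \<open>Applying Schwarz-Pick to f / k needs the strict bound |f| < k. If k is attained, the
  maximum principle makes f constant, and its derivative vanishes.\<close>

lemma Schwarz_Pick_bounded:
  assumes f: "f holomorphic_on unit_disk" "\<And>z. cmod z < 1 \<Longrightarrow> cmod (f z) \<le> k"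
    and k: "0 < k" and z: "cmod z < 1"
  shows "(1 - (cmod z)\<^sup>2) * cmod (deriv f z) \<le> (k\<^sup>2 - (cmod (f z))\<^sup>2) / k"
proof (cases "\<exists>\<xi>. cmod \<xi> < 1 \<and> cmod (f \<xi>) = k")
  case True
  then obtain \<xi> where \<xi>: "cmod \<xi> < 1" "cmod (f \<xi>) = k" by blast
  have "f constant_on unit_disk"
    by (rule maximum_modulus_principle[where U = unit_disk and \<xi> = \<xi>]) (use \<xi> f in auto)
  then obtain c where c: "\<And>z. z \<in> unit_disk \<Longrightarrow> f z = c" unfolding constant_on_def by blast
  have "deriv f z = deriv (\<lambda>_. c) z"
    using c z f(1) by (intro complex_derivative_transform_within_open[where s = unit_disk]) auto
  moreover have "(cmod (f z))\<^sup>2 \<le> k\<^sup>2" using f(2)[OF z] by (simp add: power_mono)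
  ultimately show ?thesis using k by simp
next
  case False
  define u where "u z = f z / of_real k" for z
  have "u holomorphic_on unit_disk" unfolding u_def using k by (intro holomorphic_intros f) auto
  moreover have "cmod (u z) < 1" if "cmod z < 1" for z
    using f(2)[OF that] False that k by (force simp: u_def norm_divide)
  ultimately have "(1 - (cmod z)\<^sup>2) * cmod (deriv u z) \<le> 1 - (cmod (u z))\<^sup>2"
    using Schwarz_Pick z by blast
  moreover have "(u has_field_derivative deriv f z / of_real k) (at z)"
    unfolding u_def using holomorphic_derivI[OF f(1) open_ball, of z] z by (intro DERIV_cdivide) auto
  then have "deriv u z = deriv f z / of_real k" by (rule DERIV_imp_deriv)
  ultimately have "(1 - (cmod z)\<^sup>2) * (cmod (deriv f z) / k) \<le> 1 - (cmod (f z) / k)\<^sup>2"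
    using k by (simp add: u_def norm_divide)
  then have "k * ((1 - (cmod z)\<^sup>2) * (cmod (deriv f z) / k)) \<le> k * (1 - (cmod (f z) / k)\<^sup>2)"
    using k by (intro mult_left_mono) auto
  also have "k * (1 - (cmod (f z) / k)\<^sup>2) = (k\<^sup>2 - (cmod (f z))\<^sup>2) / k"
    using k by (simp add: field_simps power2_eq_square)
  finally show ?thesis using k by simp
qed

lemma ps_norm_cong: "(\<And>z. z \<in> unit_disk \<Longrightarrow> P z = Q z) \<Longrightarrow> ps_norm P = ps_norm Q"
  unfolding ps_norm_def by (intro SUP_cong) auto

lemma sup_norm_cong: "(\<And>z. z \<in> unit_disk \<Longrightarrow> P z = Q z) \<Longrightarrow> sup_norm P = sup_norm Q"
  unfolding sup_norm_def by (intro SUP_cong) auto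

lemma norm_dilatation_le_sup_norm:
  assumes f: "sense_preserving_decomp f h g" and z: "z \<in> unit_disk"
  shows "cmod (dilatation f z) \<le> sup_norm (dilatation f)"
  unfolding sup_norm_def
  by (intro cSUP_upper z bdd_aboveI[of _ 1])
     (use sense_preserving_decomp_dilatation(2)[OF f] in \<open>auto intro: less_imp_le\<close>)

lemma ps_norm_diff_le:
  assumes f: "sense_preserving_decomp f h g" and less: "sup_norm (dilatation f) < 1"
  shows "ps_norm (\<lambda>z. analytic_pre_schwarzian h z - pre_schwarzian f z)
    \<le> ereal (C_bound (sup_norm (dilatation f)))"
proof -
  define k where "k = sup_norm (dilatation f)"
  note \<omega> = sense_preserving_decomp_dilatation[OF f]
  have le: "cmod (dilatation f z) \<le> k" if "cmod z < 1" for z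
    using norm_dilatation_le_sup_norm[OF f, of z] that by (simp add: k_def)
  have k: "0 \<le> k" "k < 1" using le[of 0] less by (auto simp: k_def intro: order_trans[OF norm_ge_zero])
  have "(1 - (cmod z)\<^sup>2) * cmod (analytic_pre_schwarzian h z - pre_schwarzian f z) \<le> C_bound k"
    if z: "cmod z < 1" for z
  proof (cases "k = 0")
    \<comment> \<open>The general bound divides by k. For k = 0 the dilatation vanishes, hence so
      does the difference.\<close>
    case True
    then have "dilatation f z = 0" using le[OF z] by simp
    then show ?thesis using z by (simp add: \<omega>(3) True C_bound_def)
  next
    case False
    define t where "t = cmod (dilatation f z)"
    have t: "0 \<le> t" "t \<le> k" using le[OF z] by (simp_all add: t_def)
    have t1: "0 < 1 - t\<^sup>2" using t k by (simp add: abs_square_less_1)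
    have "cmod (analytic_pre_schwarzian h z - pre_schwarzian f z)
        = t * cmod (deriv (dilatation f) z) / (1 - t\<^sup>2)"
      using z t1 by (simp add: \<omega>(3) norm_divide norm_mult t_def del: of_real_diff of_real_power)
    then have "(1 - (cmod z)\<^sup>2) * cmod (analytic_pre_schwarzian h z - pre_schwarzian f z)
        = t / (1 - t\<^sup>2) * ((1 - (cmod z)\<^sup>2) * cmod (deriv (dilatation f) z))"
      by simp
    also have "\<dots> \<le> t / (1 - t\<^sup>2) * ((k\<^sup>2 - t\<^sup>2) / k)"
      using Schwarz_Pick_bounded[OF \<omega>(1) le _ z] False k t t1
      by (intro mult_left_mono) (auto simp: t_def)
    also have "\<dots> = t * (k\<^sup>2 - t\<^sup>2) / (k * (1 - t\<^sup>2))" by simp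
    also have "\<dots> \<le> C_bound k" using C_bound_maximum[OF _ k(2) t] False k by simp
    finally show ?thesis .
  qed
  then show ?thesis unfolding ps_norm_def k_def[symmetric] by (intro SUP_least) auto
qed

section \<open>Balancing and the closure of the range of the dilatation\<close>

definition dilatation_hull :: "(complex \<Rightarrow> complex) \<Rightarrow> complex set" where
  "dilatation_hull f = closure (dilatation f ` unit_disk)"

text \<open>A norm below 1 keeps the closure inside the open disk, as the results on circumcenters
  require.\<close>

lemma dilatation_hull:
  assumes f: "sense_preserving_decomp f h g" and less: "sup_norm (dilatation f) < 1"
  shows "compact (dilatation_hull f)" "dilatation_hull f \<noteq> {}" "dilatation_hull f \<subseteq> ball 0 1"
    and "pseudo_ecc (dilatation_hull f) 0 = sup_norm (dilatation f)"
proof -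
  have "dilatation f ` unit_disk \<subseteq> cball 0 (sup_norm (dilatation f))"
    using norm_dilatation_le_sup_norm[OF f] by auto
  then have sub: "dilatation_hull f \<subseteq> cball 0 (sup_norm (dilatation f))"
    unfolding dilatation_hull_def by (intro closure_minimal) auto
  then show "compact (dilatation_hull f)"
    using bounded_subset[OF bounded_cball] by (simp add: compact_eq_bounded_closed dilatation_hull_def)
  show ne: "dilatation_hull f \<noteq> {}" by (simp add: dilatation_hull_def)
  show ball: "dilatation_hull f \<subseteq> ball 0 1" using sub less by auto
  show "pseudo_ecc (dilatation_hull f) 0 = sup_norm (dilatation f)"
    using pseudo_ecc_closure_0[of "dilatation f ` unit_disk"] ball
    by (simp add: dilatation_hull_def sup_norm_def image_image)
qed

lemma op_affineE:
  assumes "op_affine A"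
  obtains a b c where "cmod b < cmod a" "A = (\<lambda>w. a * w + b * cnj w + c)"
  using assms unfolding op_affine_def by blast

lemma affine_comp_decomp:
  assumes f: "sense_preserving_decomp f h g" and A: "op_affine A"
  obtains H G where "sense_preserving_decomp (A \<circ> f) H G"
proof -
  obtain a b c where "cmod b < cmod a" and "A = (\<lambda>w. a * w + b * cnj w + c)"
    using A by (rule op_affineE)
  then show ?thesis using sense_preserving_affine(1)[OF f, of b a c] that by (simp add: o_def)
qed

lemma sense_preserving_decomp_cong:
  assumes "sense_preserving_decomp f h g" "harmonic_decomp f H G"
  shows "sense_preserving_decomp f H G"
  using assms harmonic_decomp_deriv_unique[of f h g H G]
  by (auto simp: sense_preserving_decomp_def)

lemma pre_schwarzian_affine:
  assumes f: "sense_preserving_decomp f h g" and A: "op_affine A" and z: "z \<in> unit_disk"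
  shows "pre_schwarzian (A \<circ> f) z = pre_schwarzian f z"
  using A sense_preserving_affine(3)[OF f _ z] by (elim op_affineE) (simp add: o_def)

context
  fixes f h g :: "complex \<Rightarrow> complex"
  assumes f: "sense_preserving_decomp f h g" and less: "sup_norm (dilatation f) < 1"
begin

lemma dilatation_hull_affine:
  assumes ab: "cmod b < cmod a"
  shows "dilatation_hull ((\<lambda>w. a * w + b * cnj w + c) \<circ> f) = disk_aut a b ` dilatation_hull f"
proof -
  have "dilatation ((\<lambda>w. a * w + b * cnj w + c) \<circ> f) ` unit_disk = disk_aut a b ` dilatation f ` unit_disk"
    using sense_preserving_affine(2)[OF f ab] by (auto simp: o_def image_image intro!: image_cong)
  then show ?thesis
    using closure_disk_aut_image[OF _ ab] dilatation_hull(3)[OF f less] by (simp add: dilatation_hull_def)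
qed

lemma c_aff_affine:
  assumes ab: "cmod b < cmod a"
  shows "c_aff ((\<lambda>w. a * w + b * cnj w + c) \<circ> f) = disk_aut a b (hyp_center (dilatation_hull f))"
  using hyp_center_disk_aut[OF dilatation_hull(1-3)[OF f less] ab] dilatation_hull_affine[OF ab]
  by (simp add: c_aff_def dilatation_hull_def)

text \<open>\<open>disk_aut (cnj a) (- b) 0\<close> is the point sent to the origin. The norm thus
  becomes the eccentricity of a fixed set at a variable center, ready for minimization.\<close>

lemma sup_norm_dilatation_affine:
  assumes ab: "cmod b < cmod a"
  shows "sup_norm (dilatation ((\<lambda>w. a * w + b * cnj w + c) \<circ> f))
    = pseudo_ecc (dilatation_hull f) (disk_aut (cnj a) (- b) 0)"
proof -
  let ?A = "\<lambda>w. a * w + b * cnj w + c"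
  note E = dilatation_hull[OF f less]
  have eq: "disk_aut a b ` dilatation_hull f = closure (dilatation (?A \<circ> f) ` unit_disk)"
    using dilatation_hull_affine[OF ab] by (simp add: dilatation_hull_def)
  have "sup_norm (dilatation (?A \<circ> f)) = pseudo_ecc (disk_aut a b ` dilatation_hull f) 0"
    using pseudo_ecc_closure_0[of "dilatation (?A \<circ> f) ` unit_disk"]
      compact_disk_aut_image(3)[OF E(1-3) ab]
    by (simp add: eq sup_norm_def image_image)
  also have "\<dots> = pseudo_ecc (disk_aut a b ` dilatation_hull f) (disk_aut a b (disk_aut (cnj a) (- b) 0))"
    using disk_aut_inverse(2)[OF ab, of 0] by simp
  also have "\<dots> = pseudo_ecc (dilatation_hull f) (disk_aut (cnj a) (- b) 0)"
    using ab by (intro pseudo_ecc_disk_aut E norm_disk_aut_less_1) auto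
  finally show ?thesis .
qed

lemma sup_norm_dilatation_affine_less_1:
  assumes "op_affine A"
  shows "sup_norm (dilatation (A \<circ> f)) < 1"
  using assms
proof (elim op_affineE)
  fix a b c assume ab: "cmod b < cmod a" and A: "A = (\<lambda>w. a * w + b * cnj w + c)"
  have "cmod (disk_aut (cnj a) (- b) 0) < 1" using ab by (intro norm_disk_aut_less_1) auto
  then show ?thesis
    using pseudo_ecc_bounds(2)[OF dilatation_hull(1-3)[OF f less]]
    by (simp only: A sup_norm_dilatation_affine[OF ab])
qed

lemma k_aff_eq: "k_aff f = pseudo_ecc (dilatation_hull f) (hyp_center (dilatation_hull f))"
  using tanh_hyp_rad[OF dilatation_hull(1-3)[OF f less]]
  by (simp add: k_aff_def r_aff_def dilatation_hull_def)

lemma sup_norm_dilatation_balanced: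
  assumes "balancing A f"
  shows "sup_norm (dilatation (A \<circ> f)) = k_aff f"
proof -
  have "op_affine A" and c0: "c_aff (A \<circ> f) = 0" using assms by (simp_all add: balancing_def)
  then obtain a b c where ab: "cmod b < cmod a" and A: "A = (\<lambda>w. a * w + b * cnj w + c)"
    by (elim op_affineE)
  have "disk_aut a b (hyp_center (dilatation_hull f)) = 0"
    using c0 by (simp only: A c_aff_affine[OF ab])
  then have "disk_aut (cnj a) (- b) 0 = hyp_center (dilatation_hull f)"
    using disk_aut_inverse(1)[OF ab hyp_center_in_disk[OF dilatation_hull(1-3)[OF f less]]] by simp
  then show ?thesis by (simp only: A sup_norm_dilatation_affine[OF ab] k_aff_eq)
qed

lemma k_aff_le_sup_norm_dilatation:
  assumes "op_affine A"
  shows "k_aff f \<le> sup_norm (dilatation (A \<circ> f))"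
  using assms
proof (elim op_affineE)
  fix a b c assume ab: "cmod b < cmod a" and A: "A = (\<lambda>w. a * w + b * cnj w + c)"
  have "cmod (disk_aut (cnj a) (- b) 0) < 1" using ab by (intro norm_disk_aut_less_1) auto
  then show ?thesis
    using pseudo_ecc_hyp_center_le[OF dilatation_hull(1-3)[OF f less]]
    by (simp only: A sup_norm_dilatation_affine[OF ab] k_aff_eq)
qed

lemma balancing_exists: "\<exists>A. balancing A f"
proof -
  define e where "e = hyp_center (dilatation_hull f)"
  have e: "cmod (- cnj e) < cmod (1::complex)"
    using hyp_center_in_disk[OF dilatation_hull(1-3)[OF f less]] by (simp add: e_def)
  \<comment> \<open>The induced automorphism is z -> (z - e) / (1 - cnj e z), which moves the
    circumcenter \<open>e\<close> to the origin.\<close>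
  have "balancing (\<lambda>w. 1 * w + (- cnj e) * cnj w + 0) f"
    unfolding balancing_def
  proof
    show "op_affine (\<lambda>w. 1 * w + (- cnj e) * cnj w + 0)"
      unfolding op_affine_def using e by blast
    show "c_aff ((\<lambda>w. 1 * w + (- cnj e) * cnj w + 0) \<circ> f) = 0"
      unfolding c_aff_affine[OF e] e_def[symmetric] by (simp add: disk_aut_def)
  qed
  then show ?thesis by blast
qed

text \<open>The normalization is itself affine. Being balanced means cnj a e + cnj b = 0 at the
  circumcenter e, a condition unaffected by translation and by dividing a and b by the same nonzero
  number.\<close>

lemma balanced_rep_eq_affine:
  obtains B where "balancing B f" "balanced_rep f = B \<circ> f"
proof -
  define A where "A = (SOME A. balancing A f)"
  have bal: "balancing A f" unfolding A_def using balancing_exists by (rule someI_ex)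
  then obtain a b c where ab: "cmod b < cmod a" and A: "A = (\<lambda>w. a * w + b * cnj w + c)"
    by (auto simp: balancing_def elim: op_affineE)
  obtain H G where HG: "sense_preserving_decomp (A \<circ> f) H G"
    using affine_comp_decomp[OF f, of A] bal by (auto simp: balancing_def)
  define l where "l = wirtinger_z (A \<circ> f) 0"
  have l0: "l \<noteq> 0"
    using wirtinger_z_harmonic[OF sense_preserving_decompD(1)[OF HG], of 0] sense_preserving_decompD(5)[OF HG, of 0]
    by (simp add: l_def)
  define B where "B = (\<lambda>w. (a / l) * w + (b / l) * cnj w + (c - A (f 0)) / l)"
  have abl: "cmod (b / l) < cmod (a / l)" using ab l0 by (simp add: norm_divide divide_strict_right_mono)
  have "disk_aut a b (hyp_center (dilatation_hull f)) = 0"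
    using bal c_aff_affine[OF ab] by (simp add: balancing_def A)
  moreover have "a + b * hyp_center (dilatation_hull f) \<noteq> 0"
    using disk_aut_denom_nonzero[OF ab] hyp_center_in_disk[OF dilatation_hull(1-3)[OF f less]] by simp
  ultimately have "cnj a * hyp_center (dilatation_hull f) + cnj b = 0" by (simp add: disk_aut_def)
  then have "cnj (a / l) * hyp_center (dilatation_hull f) + cnj (b / l) = 0"
    using l0 by (simp add: field_simps)
  then have "c_aff (B \<circ> f) = 0" unfolding B_def c_aff_affine[OF abl] by (simp add: disk_aut_def)
  moreover have "op_affine B" unfolding B_def op_affine_def using abl by blast
  ultimately have "balancing B f" by (simp add: balancing_def)
  moreover have "balanced_rep f = B \<circ> f"
    unfolding balanced_rep_def A_def[symmetric] l_def[symmetric] Let_def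
    by (simp add: fun_eq_iff B_def) (simp add: A add_divide_distrib diff_divide_distrib)
  ultimately show ?thesis by (rule that)
qed

lemma affine_ps_norm:
  assumes A: "op_affine A" and dc: "harmonic_decomp (A \<circ> f) H G"
  shows "ps_norm (\<lambda>z. analytic_pre_schwarzian H z - pre_schwarzian f z)
      = ps_norm (\<lambda>z. analytic_pre_schwarzian H z - pre_schwarzian (A \<circ> f) z)"
    and "ps_norm (\<lambda>z. analytic_pre_schwarzian H z - pre_schwarzian f z)
      \<le> ereal (C_bound (sup_norm (dilatation (A \<circ> f))))"
    and "sup_norm (\<lambda>z. deriv G z / deriv H z) = sup_norm (dilatation (A \<circ> f))"
proof -
  obtain H' G' where "sense_preserving_decomp (A \<circ> f) H' G'" using affine_comp_decomp[OF f A] .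
  then have HG: "sense_preserving_decomp (A \<circ> f) H G" using dc by (rule sense_preserving_decomp_cong)
  show eq: "ps_norm (\<lambda>z. analytic_pre_schwarzian H z - pre_schwarzian f z)
      = ps_norm (\<lambda>z. analytic_pre_schwarzian H z - pre_schwarzian (A \<circ> f) z)"
    by (intro ps_norm_cong) (simp add: pre_schwarzian_affine[OF f A])
  show "ps_norm (\<lambda>z. analytic_pre_schwarzian H z - pre_schwarzian f z)
      \<le> ereal (C_bound (sup_norm (dilatation (A \<circ> f))))"
    unfolding eq using ps_norm_diff_le[OF HG sup_norm_dilatation_affine_less_1[OF A]] .
  show "sup_norm (\<lambda>z. deriv G z / deriv H z) = sup_norm (dilatation (A \<circ> f))"
    by (intro sup_norm_cong) (simp add: harmonic_parts_eq(1)[OF dc])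
qed

end

text \<open>Equality holds for the dilatation \<open>\<omega> z = k z\<close>, whose image is a disk centred at the origin,
  at the point \<open>z = sqrt x\<^sub>k / k\<close>.\<close>

lemma sharpness:
  assumes k: "0 < k" "k < 1"
  shows "\<exists>f H G. op_harmonic f \<and> sup_norm (dilatation f) < 1 \<and> k_aff f = k \<and>
    harmonic_decomp (balanced_rep f) H G \<and>
    ps_norm (\<lambda>z. analytic_pre_schwarzian H z - pre_schwarzian f z) = ereal (C_bound k)"
proof -
  \<comment> \<open>With analytic part z this choice gives g' / h' = k z.\<close>
  define g :: "complex \<Rightarrow> complex" where "g z = of_real k * z\<^sup>2 / 2" for z
  define f :: "complex \<Rightarrow> complex" where "f z = z + cnj (g z)" for z
  have "(g has_field_derivative of_real k * z) (at z)" for z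
    unfolding g_def by (auto intro!: derivative_eq_intros)
  then have dg: "deriv g z = of_real k * z" for z by (rule DERIV_imp_deriv)
  have dc: "harmonic_decomp f (\<lambda>z. z) g"
    unfolding harmonic_decomp_def f_def g_def by (auto intro!: holomorphic_intros)
  have klt: "k * cmod z < 1" if "cmod z < 1" for z
    using mult_strict_mono[OF k(2) that] by simp
  have f: "sense_preserving_decomp f (\<lambda>z. z) g"
    using k dc klt by (auto simp: sense_preserving_decomp_def dg norm_mult)
  have dil: "dilatation f z = of_real k * z" if "z \<in> unit_disk" for z
    by (simp add: harmonic_parts_eq(1)[OF dc that] dg)
  have sup: "sup_norm (dilatation f) = k"
  proof (rule antisym)
    show "sup_norm (dilatation f) \<le> k"
      unfolding sup_norm_def using k by (intro cSUP_least) (auto simp: dil norm_mult mult_left_le)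
    \<comment> \<open>The supremum is not attained in the open disk; it is approached along real
      points t < 1.\<close>
    show "k \<le> sup_norm (dilatation f)"
    proof (rule field_le_mult_one_interval)
      fix t :: real assume t: "0 < t" "t < 1"
      have "cmod (dilatation f (of_real t)) \<le> sup_norm (dilatation f)"
        using t by (intro norm_dilatation_le_sup_norm[OF f]) simp
      then show "t * k \<le> sup_norm (dilatation f)" using t k by (simp add: dil norm_mult mult.commute)
    qed
  qed
  then have less: "sup_norm (dilatation f) < 1" using k by simp
  note E = dilatation_hull[OF f less]
  \<comment> \<open>As cnj i / i = -1, these coefficients give the rotation z -> -z. The hull is
    symmetric under it, so the center equals its own negative.\<close>
  have ii: "cmod 0 < cmod \<i>" by simp
  have rot: "disk_aut \<i> 0 z = - z" for z by (simp add: disk_aut_def)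
  have "disk_aut \<i> 0 ` dilatation f ` unit_disk = dilatation f ` unit_disk"
  proof
    show "disk_aut \<i> 0 ` dilatation f ` unit_disk \<subseteq> dilatation f ` unit_disk"
    proof
      fix w assume "w \<in> disk_aut \<i> 0 ` dilatation f ` unit_disk"
      then obtain z where "z \<in> unit_disk" "w = - dilatation f z" by (auto simp: rot)
      then show "w \<in> dilatation f ` unit_disk" by (intro image_eqI[of _ _ "- z"]) (auto simp: dil)
    qed
    show "dilatation f ` unit_disk \<subseteq> disk_aut \<i> 0 ` dilatation f ` unit_disk"
    proof
      fix w assume "w \<in> dilatation f ` unit_disk"
      then obtain z where z: "z \<in> unit_disk" "w = dilatation f z" by auto
      then have "w = disk_aut \<i> 0 (dilatation f (- z))" "- z \<in> unit_disk" by (auto simp: dil rot)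
      then show "w \<in> disk_aut \<i> 0 ` dilatation f ` unit_disk" by blast
    qed
  qed
  then have "disk_aut \<i> 0 ` dilatation_hull f = dilatation_hull f"
    using closure_disk_aut_image[OF E(3)[unfolded dilatation_hull_def] ii]
    by (simp only: dilatation_hull_def)
  then have "hyp_center (dilatation_hull f) = - hyp_center (dilatation_hull f)"
    using hyp_center_disk_aut[OF E(1-3) ii] by (simp only: rot)
  then have center: "hyp_center (dilatation_hull f) = 0" by simp
  have kaff: "k_aff f = k" by (simp add: k_aff_eq[OF f less] center E(4) sup)
  obtain B where B: "balancing B f" "balanced_rep f = B \<circ> f"
    using balanced_rep_eq_affine[OF f less] .
  then obtain a b c where ab: "cmod b < cmod a" and Beq: "B = (\<lambda>w. a * w + b * cnj w + c)"
    by (auto simp: balancing_def elim: op_affineE)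
  have affB: "op_affine B" using B by (simp add: balancing_def)
  have a0: "a \<noteq> 0" using ab by auto
  \<comment> \<open>The balancing map behind \<open>balanced_rep\<close> is a choice, but a center
    already at 0 forces b = 0, so the dilatation only gains the unimodular factor
    \<open>cnj a / a\<close>.\<close>
  have "disk_aut a b 0 = 0"
    using B(1) c_aff_affine[OF f less ab, of c] by (simp add: balancing_def Beq center)
  then have b0: "b = 0" using a0 by (simp add: disk_aut_def)
  obtain H G where HG: "sense_preserving_decomp (B \<circ> f) H G" using affine_comp_decomp[OF f affB] .
  note dcB = sense_preserving_decompD(1)[OF HG]
  define u where "u = cnj a / a * of_real k"
  have u: "cmod u = k" using a0 k by (simp add: u_def norm_mult norm_divide)
  have dilB: "dilatation (B \<circ> f) z = u * z" if "z \<in> unit_disk" for z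
    using sense_preserving_affine(2)[OF f ab that, of c] that
    by (simp add: Beq o_def dil disk_aut_def b0 u_def)
  have ddilB: "deriv (dilatation (B \<circ> f)) z = u" if "z \<in> unit_disk" for z
  proof -
    have "deriv (dilatation (B \<circ> f)) z = deriv (\<lambda>z. u * z) z"
      by (rule complex_derivative_transform_within_open[where s = unit_disk])
         (use that dilB sense_preserving_decomp_dilatation(1)[OF HG] in \<open>auto intro!: holomorphic_intros\<close>)
    then show ?thesis by simp
  qed
  define s where "s = sqrt (x_root k)"
  have s: "0 < s" "s\<^sup>2 = x_root k" using x_root(1)[OF k] by (simp_all add: s_def)
  have sk: "s < k" using x_root(2)[OF k] s k by (intro power2_less_imp_less[of s k]) auto
  \<comment> \<open>The dilatation divided by k is a rotation, so Schwarz-Pick is an equality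
    everywhere; at this point its modulus is \<open>s\<close>, the maximizer in
    \<open>C_bound_maximum\<close>.\<close>
  define z where "z = complex_of_real (s / k)"
  have z: "z \<in> unit_disk" "cmod z = s / k" using s sk k by (simp_all add: z_def norm_divide)
  have s1: "0 < 1 - s\<^sup>2" using s(2) x_root_extremal(1)[OF k] by simp
  have W: "cmod (dilatation (B \<circ> f) z) = s" "cmod (deriv (dilatation (B \<circ> f)) z) = k"
    using k by (simp_all add: dilB[OF z(1)] ddilB[OF z(1)] norm_mult u z(2))
  have "cmod (analytic_pre_schwarzian H z - pre_schwarzian (B \<circ> f) z) = s * k / (1 - s\<^sup>2)"
    using s1 unfolding sense_preserving_decomp_dilatation(3)[OF HG z(1)] norm_mult norm_divide norm_of_real
      complex_mod_cnj W by simp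
  then have "(1 - (cmod z)\<^sup>2) * cmod (analytic_pre_schwarzian H z - pre_schwarzian (B \<circ> f) z)
      = (1 - (s / k)\<^sup>2) * (s * k / (1 - s\<^sup>2))"
    by (simp only: z(2))
  also have "\<dots> = s * (k\<^sup>2 - s\<^sup>2) / (k * (1 - s\<^sup>2))"
    using k s1 by (simp add: divide_simps power2_eq_square)
  also have "\<dots> = C_bound k" unfolding C_bound_eq(1)[OF k] s_def[symmetric] s(2) by (rule refl)
  finally have "ereal (C_bound k) \<le> ps_norm (\<lambda>z. analytic_pre_schwarzian H z - pre_schwarzian (B \<circ> f) z)"
    unfolding ps_norm_def by (intro SUP_upper2[OF z(1)]) simp
  moreover have "ps_norm (\<lambda>z. analytic_pre_schwarzian H z - pre_schwarzian f z) \<le> ereal (C_bound k)"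
    using affine_ps_norm(2)[OF f less affB dcB] sup_norm_dilatation_balanced[OF f less B(1)] kaff by simp
  ultimately have "ps_norm (\<lambda>z. analytic_pre_schwarzian H z - pre_schwarzian f z) = ereal (C_bound k)"
    using affine_ps_norm(1)[OF f less affB dcB] by simp
  then show ?thesis
    using f less kaff dcB B(2) op_harmonic_iff by (intro exI[of _ f] exI[of _ H] exI[of _ G]) auto
qed

theorem theorem1p5:
  shows
   "(\<forall>f. op_harmonic f \<and> sup_norm (dilatation f) < 1 \<longrightarrow>
       (\<exists>A. balancing A f) \<and>
       op_harmonic (balanced_rep f) \<and>
       (\<forall>H G k. harmonic_decomp (balanced_rep f) H G \<and>
           k = sup_norm (\<lambda>z. deriv G z / deriv H z) \<longrightarrow>
           k = k_aff f \<and> k < 1 \<and>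
           ps_norm (\<lambda>z. analytic_pre_schwarzian H z - pre_schwarzian f z) =
             ps_norm (\<lambda>z. analytic_pre_schwarzian H z - pre_schwarzian (balanced_rep f) z) \<and>
           ps_norm (\<lambda>z. analytic_pre_schwarzian H z - pre_schwarzian f z)
             \<le> ereal (C_bound k)) \<and>
       (\<forall>A H G. op_affine A \<and> harmonic_decomp (A \<circ> f) H G \<longrightarrow>
           ps_norm (\<lambda>z. analytic_pre_schwarzian H z - pre_schwarzian f z)
             \<le> ereal (C_bound (sup_norm (dilatation (A \<circ> f))))) \<and>
       (\<forall>A A'. balancing A f \<and> op_affine A' \<longrightarrow>
           sup_norm (dilatation (A \<circ> f)) \<le> sup_norm (dilatation (A' \<circ> f))))
    \<and> (\<forall>k. 0 < k \<and> k < 1 \<longrightarrow>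
         (\<exists>!x. 0 < x \<and> x < 1 \<and> extremal_eq k x) \<and>
         x_sol k = (3 - k\<^sup>2 - sqrt ((1 - k\<^sup>2) * (9 - k\<^sup>2))) / 2 \<and>
         C_bound k = sqrt (x_sol k) * (k\<^sup>2 - x_sol k) / (k * (1 - x_sol k)) \<and>
         C_bound k = 2 * x_sol k powr (3/2) / (k * (1 + x_sol k)))
    \<and> C_bound 0 = 0
    \<and> (\<forall>k. 0 < k \<and> k < 1 \<longrightarrow>
         (\<exists>f H G. op_harmonic f \<and> sup_norm (dilatation f) < 1 \<and> k_aff f = k \<and>
            harmonic_decomp (balanced_rep f) H G \<and>
            ps_norm (\<lambda>z. analytic_pre_schwarzian H z - pre_schwarzian f z) =
              ereal (C_bound k)))
    \<and> (\<lambda>k. C_bound k - 2 / (3 * sqrt 3) * k\<^sup>2) \<in> O[at_right 0](\<lambda>k. k ^ 4)"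
proof (rule conjI[OF _ conjI[OF _ conjI[OF _ conjI]]]; (intro allI impI)?)
  fix f assume "op_harmonic f \<and> sup_norm (dilatation f) < 1"
  then obtain h g where f: "sense_preserving_decomp f h g" and less: "sup_norm (dilatation f) < 1"
    by (auto simp: op_harmonic_iff)
  obtain B where B: "balancing B f" "balanced_rep f = B \<circ> f"
    using balanced_rep_eq_affine[OF f less] .
  have affB: "op_affine B" using B(1) by (simp add: balancing_def)
  note affine = affine_ps_norm[OF f less] and balanced = sup_norm_dilatation_balanced[OF f less]
  have "op_harmonic (balanced_rep f)"
    unfolding B(2) op_harmonic_iff using affine_comp_decomp[OF f affB] by metis
  moreover have "k = k_aff f \<and> k < 1 \<and>
      ps_norm (\<lambda>z. analytic_pre_schwarzian H z - pre_schwarzian f z) =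
        ps_norm (\<lambda>z. analytic_pre_schwarzian H z - pre_schwarzian (balanced_rep f) z) \<and>
      ps_norm (\<lambda>z. analytic_pre_schwarzian H z - pre_schwarzian f z) \<le> ereal (C_bound k)"
    if HG: "harmonic_decomp (balanced_rep f) H G" and k: "k = sup_norm (\<lambda>z. deriv G z / deriv H z)" for H G k
  proof -
    have dc: "harmonic_decomp (B \<circ> f) H G" using HG B(2) by simp
    have "k = sup_norm (dilatation (B \<circ> f))" using affine(3)[OF affB dc] k by simp
    then show ?thesis
      using affine(1,2)[OF affB dc] balanced[OF B(1)] sup_norm_dilatation_affine_less_1[OF f less affB] B(2)
      by metis
  qed
  moreover have "sup_norm (dilatation (A \<circ> f)) \<le> sup_norm (dilatation (A' \<circ> f))"
    if "balancing A f" "op_affine A'" for A A'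
    using k_aff_le_sup_norm_dilatation[OF f less that(2)] balanced[OF that(1)] by simp
  ultimately show "(\<exists>A. balancing A f) \<and>
       op_harmonic (balanced_rep f) \<and>
       (\<forall>H G k. harmonic_decomp (balanced_rep f) H G \<and>
           k = sup_norm (\<lambda>z. deriv G z / deriv H z) \<longrightarrow>
           k = k_aff f \<and> k < 1 \<and>
           ps_norm (\<lambda>z. analytic_pre_schwarzian H z - pre_schwarzian f z) =
             ps_norm (\<lambda>z. analytic_pre_schwarzian H z - pre_schwarzian (balanced_rep f) z) \<and>
           ps_norm (\<lambda>z. analytic_pre_schwarzian H z - pre_schwarzian f z)
             \<le> ereal (C_bound k)) \<and>
       (\<forall>A H G. op_affine A \<and> harmonic_decomp (A \<circ> f) H G \<longrightarrow>
           ps_norm (\<lambda>z. analytic_pre_schwarzian H z - pre_schwarzian f z)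
             \<le> ereal (C_bound (sup_norm (dilatation (A \<circ> f))))) \<and>
       (\<forall>A A'. balancing A f \<and> op_affine A' \<longrightarrow>
           sup_norm (dilatation (A \<circ> f)) \<le> sup_norm (dilatation (A' \<circ> f)))"
    using B(1) affine(2) by blast
next
  fix k :: real assume "0 < k \<and> k < 1"
  then have k: "0 < k" "k < 1" by simp_all
  have "\<exists>!x. 0 < x \<and> x < 1 \<and> extremal_eq k x"
    using x_root(1)[OF k] x_root_extremal[OF k] extremal_eq_unique[OF k] by (intro ex1I[of _ "x_root k"]) blast+
  then show "(\<exists>!x. 0 < x \<and> x < 1 \<and> extremal_eq k x) \<and>
         x_sol k = (3 - k\<^sup>2 - sqrt ((1 - k\<^sup>2) * (9 - k\<^sup>2))) / 2 \<and>
         C_bound k = sqrt (x_sol k) * (k\<^sup>2 - x_sol k) / (k * (1 - x_sol k)) \<and>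
         C_bound k = 2 * x_sol k powr (3/2) / (k * (1 + x_sol k))"
    unfolding x_sol_eq[OF k] using C_bound_eq(1,2)[OF k] x_root_def by blast
next
  show "C_bound 0 = 0" by (simp add: C_bound_def)
next
  fix k :: real assume "0 < k \<and> k < 1"
  then show "\<exists>f H G. op_harmonic f \<and> sup_norm (dilatation f) < 1 \<and> k_aff f = k \<and>
            harmonic_decomp (balanced_rep f) H G \<and>
            ps_norm (\<lambda>z. analytic_pre_schwarzian H z - pre_schwarzian f z) =
              ereal (C_bound k)"
    using sharpness by blast
next
  show "(\<lambda>k. C_bound k - 2 / (3 * sqrt 3) * k\<^sup>2) \<in> O[at_right 0](\<lambda>k. k ^ 4)"
    by (rule C_bound_asymptotics)
qed

end
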